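(* Let $n\in\mathbb{Z}$ with $|n|\geq1$, $\alpha>0$, $R>0$, and let $\kappa$ satisfy $$-\frac{n^2+r_0^2}{2R^2}<\kappa<\alpha^{-1}-\frac{n^2+r_0^2}{2R^2}\quad\text{and}\quad \left(\frac{6\,(1+n^2(2\ln2-1))}{\alpha^{-1}-\kappa}\right)^{1/2}<R.$$ Then there exists $u\in H$ with $u(r)>0$ for all $r\in(0,R)$ such that $(u,\kappa)$ is a solution of the $n$-vortex equation $$(ru_r)_r-\frac{n^2}{r}u+\frac{2ru^3}{1+\alpha u^2}-2\kappa ru=0\ \text{ on }(0,R),\qquad u(0)=0,\quad u(R)=0.$$
   Context: $r_0\approx2.404825$ is the first positive zero of the Bessel function $J_0$. $H$ is the completion of $\{u\in C^1[0,R]: u(0)=0=u(R)\}$ with respect to the inner product $(u,\tilde u)=\int_0^R\{ru_r\tilde u_r+\frac1r u\tilde u\}dr$. *)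

theory Defs
  imports "HOL-Analysis.Analysis"
begin

definition bessel_J0 :: "real \<Rightarrow> real" where
  "bessel_J0 x = (\<Sum>k. (-1) ^ k * (x / 2) ^ (2 * k) / (fact k) ^ 2)"

definition r0 :: real where
  "r0 = (THE r. r > 0 \<and> bessel_J0 r = 0 \<and> (\<forall>s. 0 < s \<and> s < r \<longrightarrow> bessel_J0 s \<noteq> 0))"

definition H_norm2 :: "real \<Rightarrow> (real \<Rightarrow> real) \<Rightarrow> (real \<Rightarrow> real) \<Rightarrow> real" where
  "H_norm2 R f f' = integral {0..R} (\<lambda>r. r * (f' r)^2 + (f r)^2 / r)"

definition C1_0 :: "real \<Rightarrow> (real \<Rightarrow> real) \<Rightarrow> (real \<Rightarrow> real) \<Rightarrow> bool" where
  "C1_0 R f f' \<longleftrightarrow>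
     (\<forall>r\<in>{0..R}. (f has_real_derivative f' r) (at r within {0..R})) \<and>
     continuous_on {0..R} f' \<and> f 0 = 0 \<and> f R = 0"

text \<open>Membership in H, the completion of C^1_0 w.r.t. the H-inner product:
  u is the (pointwise on (0,R)) limit of an H-Cauchy sequence of C^1_0 functions.
  Elements of the completion are identified with functions on (0,R) in this way.\<close>
definition in_H :: "real \<Rightarrow> (real \<Rightarrow> real) \<Rightarrow> bool" where
  "in_H R u \<longleftrightarrow>
     (\<exists>\<phi> \<phi>' :: nat \<Rightarrow> real \<Rightarrow> real.
        (\<forall>k. C1_0 R (\<phi> k) (\<phi>' k)) \<and>
        (\<forall>e>0. \<exists>N. \<forall>m\<ge>N. \<forall>k\<ge>N.
            H_norm2 R (\<lambda>r. \<phi> m r - \<phi> k r) (\<lambda>r. \<phi>' m r - \<phi>' k r) < e) \<and>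
        (\<forall>r\<in>{0<..<R}. (\<lambda>k. \<phi> k r) \<longlonglongrightarrow> u r))"

definition vortex_solution :: "int \<Rightarrow> real \<Rightarrow> real \<Rightarrow> (real \<Rightarrow> real) \<Rightarrow> real \<Rightarrow> bool" where
  "vortex_solution n \<alpha> R u \<kappa> \<longleftrightarrow>
     continuous_on {0..R} u \<and> u 0 = 0 \<and> u R = 0 \<and>
     (\<exists>u' u''. \<forall>r\<in>{0<..<R}.
        (u has_real_derivative u' r) (at r) \<and>
        (u' has_real_derivative u'' r) (at r) \<and>
        (u' r + r * u'' r) - (of_int n)^2 / r * u r
          + 2 * r * (u r)^3 / (1 + \<alpha> * (u r)^2) - 2 * \<kappa> * r * u r = 0)"

end

theory Submission
  imports Defs
begin

text \<open>Shooting. Writing \<open>m = \<bar>n\<bar>\<close> and \<open>u = r\<^sup>m v\<close> removes the singularity of the equation at \<open>0\<close>, so that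
  for every amplitude \<open>a = v(0)\<close> there is a solution \<open>v\<^sub>a\<close> with \<open>v\<^sub>a'(0) = 0\<close> on \<open>[0, R]\<close>, depending
  continuously on \<open>a\<close>. For small \<open>a\<close> it is governed by the linearisation at \<open>0\<close>, which by Sturm
  comparison with \<open>J\<^sub>0(r\<^sub>0 r / R)\<close> and the lower bound on \<open>\<kappa>\<close> stays positive. For large \<open>a\<close> it is
  governed by the linearisation at infinity, which takes negative values: otherwise the Picone
  inequality with a tent function would contradict the lower bound on \<open>R\<close>. Hence \<open>min v\<^sub>a\<close>
  vanishes for some \<open>a\<close>, and since zeros are simple, this \<open>v\<^sub>a\<close> vanishes at \<open>R\<close> only.\<close>

subsection \<open>Volterra integral equations\<close>

text \<open>The equation is \<open>(r u')' - n\<^sup>2 / r u + r f(u) u = 0\<close> with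
  \<open>f(u) = 2 u\<^sup>2 / (1 + \<alpha> u\<^sup>2) - 2 \<kappa>\<close>, and \<open>f\<close>
  increases with the amplitude from \<open>- 2 \<kappa>\<close> to the limit
  \<open>2 (1 / \<alpha> - \<kappa>)\<close>. Both bounds compare these values with the first
  Dirichlet eigenvalue on \<open>(0, R)\<close>. The lower bound on \<kappa> puts the first value
  below \<open>(n\<^sup>2 + r0\<^sup>2) / R\<^sup>2\<close>, which lies below the eigenvalue because
  \<open>n\<^sup>2 / r\<^sup>2 \<ge> n\<^sup>2 / R\<^sup>2\<close>. The lower bound on
  \<open>R\<close> puts the limit above \<open>12 (1 + n\<^sup>2 (2 ln 2 - 1)) / R\<^sup>2\<close>,
  the Rayleigh quotient of the tent function. Since \<open>f\<close> is bounded and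
  \<open>f(u) u\<close> is Lipschitz, no solution blows up before \<open>R\<close>, and the minimum
  over \<open>[0, R]\<close> is a Lipschitz function of the amplitude. Following this minimum
  instead of the first zero spares any study of how zeros move.\<close>

lemma gronwall_integral:
  fixes d :: "real \<Rightarrow> real"
  assumes d: "continuous_on {0..R} d" and M: "M \<ge> 0"
    and le: "\<And>r. r \<in> {0..R} \<Longrightarrow> \<bar>d r\<bar> \<le> E + M * integral {0..r} (\<lambda>t. \<bar>d t\<bar>)"
    and r: "r \<in> {0..R}"
  shows "\<bar>d r\<bar> \<le> E * exp (M * r)"
proof -
  define I where "I = (\<lambda>r. integral {0..r} (\<lambda>t. \<bar>d t\<bar>))"
  have dI: "(I has_real_derivative \<bar>d x\<bar>) (at x within {0..R})" if "x \<in> {0..R}" for x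
    unfolding I_def using d that by (intro integral_has_real_derivative continuous_intros)
  \<comment> \<open>Integrating factor: with \<open>F = E + M * I\<close>, the hypothesis says
    \<open>F' \<le> M F\<close>, so \<open>exp (- (M x)) F\<close> is nonincreasing. The sign is
    flipped to suit the monotonicity rule.\<close>
  define P where "P = (\<lambda>x. - (exp (- (M * x)) * (E + M * I x)))"
  have "P 0 \<le> P r"
  proof (rule DERIV_nonneg_imp_increasing_open[where f = P])
    show "0 \<le> r" using r by simp
    show "\<exists>y. (P has_real_derivative y) (at x) \<and> 0 \<le> y" if "0 < x" "x < r" for x
    proof (intro exI conjI)
      have "x \<in> {0..R}" "x \<in> interior {0..R}" using that r by auto
      then have D: "(I has_real_derivative \<bar>d x\<bar>) (at x)"
        using dI at_within_interior by metis
      show "(P has_real_derivative M * exp (- (M * x)) * (E + M * I x - \<bar>d x\<bar>)) (at x)"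
        unfolding P_def by (auto intro!: derivative_eq_intros D simp: algebra_simps)
      show "0 \<le> M * exp (- (M * x)) * (E + M * I x - \<bar>d x\<bar>)"
        using le[OF \<open>x \<in> {0..R}\<close>] M by (simp add: I_def)
    qed
    have "continuous_on {0..R} I" using dI
      by (meson DERIV_continuous continuous_on_eq_continuous_within)
    then have "continuous_on {0..r} I" using r continuous_on_subset by fastforce
    then show "continuous_on {0..r} P" unfolding P_def by (intro continuous_intros)
  qed
  then have "exp (- (M * r)) * (E + M * I r) \<le> E" by (simp add: P_def I_def)
  then have "E + M * I r \<le> E * exp (M * r)"
    by (simp add: exp_minus field_simps)
  then show ?thesis using le[OF r] by (simp add: I_def)
qed

text \<open>In the weighted norm \<open>sup \<bar>v t\<bar> exp (- 2 M t)\<close> the map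
  \<open>T\<close> contracts by the factor 1/2, whatever the length of the interval; this is
  \<open>W\<close>. The iterates started at 0 therefore converge uniformly by the M-test.\<close>

lemma volterra_fixed_point:
  fixes T :: "(real \<Rightarrow> real) \<Rightarrow> real \<Rightarrow> real"
  assumes T: "\<And>v. continuous_on {0..R} v \<Longrightarrow> continuous_on {0..R} (T v)"
    and M: "M > 0"
    and L: "\<And>v w r. continuous_on {0..R} v \<Longrightarrow> continuous_on {0..R} w \<Longrightarrow> r \<in> {0..R} \<Longrightarrow>
       \<bar>T v r - T w r\<bar> \<le> M * integral {0..r} (\<lambda>t. \<bar>v t - w t\<bar>)"
  shows "\<exists>v. continuous_on {0..R} v \<and> (\<forall>r\<in>{0..R}. v r = T v r)"
proof -
  have W: "\<bar>T v r - T w r\<bar> \<le> C / 2 * exp (2 * M * r)"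
    if c: "continuous_on {0..R} v" "continuous_on {0..R} w" and r: "r \<in> {0..R}" and C: "C \<ge> 0"
      and le: "\<And>t. t \<in> {0..R} \<Longrightarrow> \<bar>v t - w t\<bar> \<le> C * exp (2 * M * t)" for v w r C
  proof -
    have h: "((\<lambda>t. C * exp (2 * M * t)) has_integral
        C / (2 * M) * exp (2 * M * r) - C / (2 * M) * exp (2 * M * 0)) {0..r}"
      using r M
      by (intro fundamental_theorem_of_calculus)
        (auto intro!: derivative_eq_intros simp flip: has_real_derivative_iff_has_vector_derivative)
    have i: "(\<lambda>t. \<bar>v t - w t\<bar>) integrable_on {0..r}"
      by (intro integrable_continuous_real continuous_intros continuous_on_subset[OF c(1)]
          continuous_on_subset[OF c(2)]) (use r in auto)
    have "integral {0..r} (\<lambda>t. \<bar>v t - w t\<bar>) \<le> C / (2 * M) * exp (2 * M * r) - C / (2 * M) * exp (2 * M * 0)"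
      using r le by (intro has_integral_le[OF integrable_integral[OF i] h]) auto
    also have "\<dots> \<le> C / (2 * M) * exp (2 * M * r)" using C M by simp
    finally have "M * integral {0..r} (\<lambda>t. \<bar>v t - w t\<bar>) \<le> M * (C / (2 * M) * exp (2 * M * r))"
      using M by (intro mult_left_mono) auto
    then show ?thesis using L[OF c r] M by (simp add: field_simps)
  qed
  define v where "v k = (T ^^ k) (\<lambda>_. 0)" for k
  have v0: "v 0 = (\<lambda>_. 0)" and vS: "v (Suc k) = T (v k)" for k by (auto simp: v_def)
  have cv: "continuous_on {0..R} (v k)" for k by (induction k) (auto simp: v0 vS T)
  have "bounded (v 1 ` {0..R})"
    by (intro compact_imp_bounded compact_continuous_image cv) auto
  then obtain C where C: "\<And>r. r \<in> {0..R} \<Longrightarrow> \<bar>v 1 r\<bar> \<le> C"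
    unfolding bounded_iff by (metis imageI real_norm_def)
  have C': "\<bar>v 1 r\<bar> \<le> max C 0 * exp (2 * M * r)" if "r \<in> {0..R}" for r
  proof -
    have "max C 0 * 1 \<le> max C 0 * exp (2 * M * r)" using that M by (intro mult_left_mono) auto
    then show ?thesis using C[OF that] by simp
  qed
  have step: "\<bar>v (Suc k) r - v k r\<bar> \<le> max C 0 / 2 ^ k * exp (2 * M * r)" if "r \<in> {0..R}" for k r
    using that
  proof (induction k arbitrary: r)
    case 0 then show ?case using C' by (simp add: v0)
  next
    case (Suc k)
    have "\<bar>T (v (Suc k)) r - T (v k) r\<bar> \<le> max C 0 / 2 ^ k / 2 * exp (2 * M * r)"
      by (rule W) (use Suc cv in auto)
    then show ?case by (simp add: vS mult_ac)
  qed
  define B where "B = max C 0 * exp (2 * M * R)"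
  have stepB: "norm (v (Suc k) r - v k r) \<le> B * (1/2) ^ k" if "r \<in> {0..R}" for k r
  proof -
    have "max C 0 / 2 ^ k * exp (2 * M * r) \<le> max C 0 / 2 ^ k * exp (2 * M * R)"
      using that M by (intro mult_left_mono) auto
    then show ?thesis using step[OF that, of k] by (simp add: B_def power_one_over field_simps)
  qed
  have "uniform_limit {0..R} (\<lambda>n x. \<Sum>k<n. v (Suc k) x - v k x) (\<lambda>x. \<Sum>k. v (Suc k) x - v k x) sequentially"
    by (rule Weierstrass_m_test[OF stepB]) (auto intro!: summable_mult)
  moreover have "(\<Sum>k<n. v (Suc k) x - v k x) = v n x" for n x
    by (subst sum_lessThan_telescope) (simp add: v0)
  ultimately have ul: "uniform_limit {0..R} v (\<lambda>x. \<Sum>k. v (Suc k) x - v k x) sequentially" by simp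
  define V where "V = (\<lambda>x. \<Sum>k. v (Suc k) x - v k x)"
  have cV: "continuous_on {0..R} V" unfolding V_def
    by (rule uniform_limit_theorem[OF _ ul]) (auto simp: cv)
  have "V r = T V r" if r: "r \<in> {0..R}" for r
  proof -
    have "(\<lambda>k. v (Suc k) r) \<longlonglongrightarrow> V r"
      using tendsto_uniform_limitI[OF ul r] unfolding V_def by (rule LIMSEQ_Suc)
    moreover have "(\<lambda>k. v (Suc k) r) \<longlonglongrightarrow> T V r"
    proof (rule LIMSEQ_I)
      fix e :: real assume e: "e > 0"
      define e' where "e' = e / exp (2 * M * r)"
      have e': "e' > 0" using e by (simp add: e'_def)
      obtain N where N: "\<And>k x. k \<ge> N \<Longrightarrow> x \<in> {0..R} \<Longrightarrow> dist (v k x) (V x) < e'"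
        using uniform_limitD[OF ul e'] unfolding eventually_sequentially V_def by blast
      show "\<exists>no. \<forall>k\<ge>no. norm (v (Suc k) r - T V r) < e"
      proof (intro exI allI impI)
        fix k assume k: "k \<ge> N"
        have "\<bar>T (v k) r - T V r\<bar> \<le> e' / 2 * exp (2 * M * r)"
        proof (rule W[OF cv cV r])
          fix t assume t: "t \<in> {0..R}"
          have "e' * 1 \<le> e' * exp (2 * M * t)" using t M e' by (intro mult_left_mono) auto
          then show "\<bar>v k t - V t\<bar> \<le> e' * exp (2 * M * t)"
            using N[OF k t] by (simp add: dist_real_def)
        qed (use e' in auto)
        also have "\<dots> < e" using e by (simp add: e'_def)
        finally show "norm (v (Suc k) r - T V r) < e" by (simp add: vS)
      qed
    qed
    ultimately show ?thesis by (rule LIMSEQ_unique)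
  qed
  with cV show ?thesis by blast
qed

subsection \<open>The radial initial value problem\<close>

text \<open>\<open>v'' + q / r v' + g = 0\<close> means
  \<open>(r\<^sup>q v')' = - r\<^sup>q g\<close>, so the solution regular at 0 has
  \<open>v' = - radial_avg q g\<close>. For continuous \<open>g\<close> and \<open>q \<ge> 1\<close>
  the quotient is \<open>O(s)\<close>, hence 0 is its limit at \<open>s = 0\<close> and
  \<open>v'(0) = 0\<close> is built in.\<close>

definition radial_avg :: "nat \<Rightarrow> (real \<Rightarrow> real) \<Rightarrow> real \<Rightarrow> real" where
  "radial_avg q g s = (if s = 0 then 0 else integral {0..s} (\<lambda>t. t ^ q * g t) / s ^ q)"

lemma radial_avg_0 [simp]: "radial_avg q g 0 = 0"
  by (simp add: radial_avg_def)

text \<open>Splitting \<open>t\<^sup>q g\<close> as \<open>t\<^sup>q\<^sup>-\<^sup>1 (t g)\<close>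
  shows that only \<open>t * \<bar>g t\<bar>\<close> has to be controlled. Errors of size
  \<open>\<epsilon> / t\<close> near 0 are thus allowed, which the comparison at large amplitude
  relies on.\<close>

lemma radial_avg_bound:
  assumes q: "q \<ge> 1" and g: "continuous_on {0..R} g" and h: "continuous_on {0..R} h"
    and \<epsilon>: "\<epsilon> \<ge> 0" and h0: "\<And>t. t \<in> {0..R} \<Longrightarrow> h t \<ge> 0"
    and le: "\<And>t. t \<in> {0..R} \<Longrightarrow> t * \<bar>g t\<bar> \<le> \<epsilon> + t * h t" and s: "s \<in> {0..R}"
  shows "\<bar>radial_avg q g s\<bar> \<le> \<epsilon> + integral {0..s} h"
proof (cases "s = 0")
  case False
  then have s0: "s > 0" using s by auto
  have sub: "{0..s} \<subseteq> {0..R}" using s by auto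
  note c = continuous_on_subset[OF g sub] continuous_on_subset[OF h sub]
  have "norm (integral {0..s} (\<lambda>t. t ^ q * g t)) \<le> integral {0..s} (\<lambda>t. s ^ (q - 1) * \<epsilon> + s ^ q * h t)"
  proof (rule integral_norm_bound_integral)
    fix t assume t: "t \<in> {0..s}"
    have [simp]: "x ^ q = x ^ (q - 1) * x" for x :: real
      using q by (metis One_nat_def Suc_le_D diff_Suc_1 power_Suc2)
    have "norm (t ^ q * g t) = t ^ (q - 1) * (t * \<bar>g t\<bar>)" using t by (simp add: abs_mult)
    also have "\<dots> \<le> t ^ (q - 1) * (\<epsilon> + t * h t)"
      using t le[of t] sub by (intro mult_left_mono) auto
    also have "\<dots> \<le> s ^ (q - 1) * (\<epsilon> + s * h t)"
      using t \<epsilon> h0[of t] sub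
      by (intro mult_mono add_left_mono mult_right_mono power_mono add_nonneg_nonneg mult_nonneg_nonneg) auto
    finally show "norm (t ^ q * g t) \<le> s ^ (q - 1) * \<epsilon> + s ^ q * h t" by (simp add: algebra_simps)
  qed (intro integrable_continuous_real continuous_intros c)+
  also have "\<dots> = s ^ (q - 1) * \<epsilon> * s + s ^ q * integral {0..s} h"
    using s0 c by (subst integral_add)
      (auto intro!: integrable_continuous_real continuous_intros)
  also have "s ^ (q - 1) * \<epsilon> * s = s ^ q * \<epsilon>"
    using q by (metis One_nat_def Suc_le_D diff_Suc_1 power_Suc2 mult.assoc mult.commute)
  finally show ?thesis using s0 by (simp add: radial_avg_def abs_divide field_simps)
qed (use \<epsilon> in auto)

lemma radial_avg_diff:
  assumes "continuous_on {0..R} g" "continuous_on {0..R} h" "s \<in> {0..R}"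
  shows "radial_avg q g s - radial_avg q h s = radial_avg q (\<lambda>t. g t - h t) s"
proof -
  have sub: "{0..s} \<subseteq> {0..R}" using assms by auto
  note c = continuous_on_subset[OF assms(1) sub] continuous_on_subset[OF assms(2) sub]
  have "integral {0..s} (\<lambda>t. t ^ q * (g t - h t)) =
      integral {0..s} (\<lambda>t. t ^ q * g t) - integral {0..s} (\<lambda>t. t ^ q * h t)"
    unfolding right_diff_distrib
    by (intro integral_diff integrable_continuous_real continuous_intros c)
  then show ?thesis by (simp add: radial_avg_def diff_divide_distrib)
qed

lemma radial_avg_linear_bound:
  assumes q: "q \<ge> 1" and g: "continuous_on {0..R} g"
  obtains C where "\<And>s. s \<in> {0..R} \<Longrightarrow> \<bar>radial_avg q g s\<bar> \<le> C * s"
proof -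
  have "bounded (g ` {0..R})" by (intro compact_imp_bounded compact_continuous_image g) auto
  then obtain C where C: "\<And>r. r \<in> {0..R} \<Longrightarrow> \<bar>g r\<bar> \<le> C"
    unfolding bounded_iff by (metis imageI real_norm_def)
  have "\<bar>radial_avg q g s\<bar> \<le> C * s" if s: "s \<in> {0..R}" for s
  proof -
    have "C \<ge> 0" using C[OF s] by linarith
    have "\<bar>radial_avg q g s\<bar> \<le> 0 + integral {0..s} (\<lambda>_. C)"
      by (rule radial_avg_bound[OF q g _ _ _ _ s]) (use C \<open>C \<ge> 0\<close> in \<open>auto intro: mult_left_mono\<close>)
    then show ?thesis using s by (simp add: mult.commute)
  qed
  then show ?thesis using that by blast
qed

lemma radial_avg_has_derivative:
  assumes g: "continuous_on {0..R} g" and s: "0 < s" "s < R"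
  shows "(radial_avg q g has_real_derivative g s - real q / s * radial_avg q g s) (at s)"
proof -
  define I where "I = (\<lambda>s. integral {0..s} (\<lambda>t. t ^ q * g t))"
  have "(I has_real_derivative s ^ q * g s) (at s within {0..R})" unfolding I_def
    using s by (intro integral_has_real_derivative continuous_intros g) auto
  then have dI: "(I has_real_derivative s ^ q * g s) (at s)"
    using s at_within_Icc_at by metis
  have "real q * s ^ (q - Suc 0) * s = real q * s ^ q" by (cases q) auto
  then have "((\<lambda>x. I x / x ^ q) has_real_derivative g s - real q / s * (I s / s ^ q)) (at s)"
    using s by (auto intro!: derivative_eq_intros dI simp: field_simps power2_eq_square)
  moreover have "eventually (\<lambda>x. x \<in> {0<..}) (nhds s)"
    using s by (intro eventually_nhds_in_open) auto
  then have "eventually (\<lambda>x. I x / x ^ q = radial_avg q g x) (nhds s)"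
    by eventually_elim (auto simp: I_def radial_avg_def)
  ultimately show ?thesis using s
    by (subst (asm) DERIV_cong_ev[OF refl _ refl]) (auto simp: I_def radial_avg_def)
qed

lemma continuous_on_radial_avg:
  assumes q: "q \<ge> 1" and g: "continuous_on {0..R} g"
  shows "continuous_on {0..R} (radial_avg q g)"
proof -
  obtain C where C: "\<And>s. s \<in> {0..R} \<Longrightarrow> \<bar>radial_avg q g s\<bar> \<le> C * s"
    using radial_avg_linear_bound[OF q g] by blast
  have "continuous (at s within {0..R}) (radial_avg q g)" if s: "s \<in> {0..R}" for s
  proof (cases "s = 0")
    case True
    have "((\<lambda>s. C * s) \<longlongrightarrow> C * 0) (at 0 within {0..R})" by (intro tendsto_intros)
    then have l: "((\<lambda>s. C * s) \<longlongrightarrow> 0) (at 0 within {0..R})" by simp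
    have "(radial_avg q g \<longlongrightarrow> 0) (at 0 within {0..R})"
      by (rule Lim_null_comparison[OF _ l])
        (use C in \<open>auto simp: eventually_at_filter intro!: always_eventually\<close>)
    then show ?thesis using True by (simp add: continuous_within)
  next
    case False
    have "continuous_on {0..R} (\<lambda>s. integral {0..s} (\<lambda>t. t ^ q * g t))"
      by (intro indefinite_integral_continuous_1 integrable_continuous_real continuous_intros g)
    then have "((\<lambda>x. integral {0..x} (\<lambda>t. t ^ q * g t)) \<longlongrightarrow> integral {0..s} (\<lambda>t. t ^ q * g t)) (at s within {0..R})"
      using s by (auto simp: continuous_on)
    then have "((\<lambda>x. integral {0..x} (\<lambda>t. t ^ q * g t) / x ^ q) \<longlongrightarrow> integral {0..s} (\<lambda>t. t ^ q * g t) / s ^ q) (at s within {0..R})"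
      using False by (intro tendsto_intros) auto
    moreover have "\<forall>\<^sub>F x in at s within {0..R}. x \<noteq> 0"
      using tendsto_imp_eventually_ne[OF tendsto_ident_at False] .
    then have "\<forall>\<^sub>F x in at s within {0..R}. integral {0..x} (\<lambda>t. t ^ q * g t) / x ^ q = radial_avg q g x"
      by eventually_elim (auto simp: radial_avg_def)
    ultimately show ?thesis using False
      unfolding continuous_within by (subst (asm) tendsto_cong) (auto simp: radial_avg_def)
  qed
  then show ?thesis by (simp add: continuous_on_eq_continuous_within)
qed

section \<open>Global existence and perturbation of radial solutions\<close>

text \<open>The Lipschitz condition concerns the term \<open>f x * x\<close> of the equation. The
  bound on \<open>f\<close> itself takes over where the factor \<open>t ^ m\<close> vanishes, and
  also feeds the energy estimate for simple zeros.\<close>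

definition lipschitz_nonlinearity :: "real \<Rightarrow> (real \<Rightarrow> real) \<Rightarrow> bool" where
  "lipschitz_nonlinearity L f \<longleftrightarrow> L > 0 \<and> continuous_on UNIV f \<and> (\<forall>x. \<bar>f x\<bar> \<le> L) \<and>
     (\<forall>x y. \<bar>f x * x - f y * y\<bar> \<le> L * \<bar>x - y\<bar>)"

text \<open>Multiplying by \<open>c\<close> turns the claim into the Lipschitz condition at
  \<open>c * v\<close> and \<open>c * w\<close>. The constant does not depend on
  \<open>c = t ^ m\<close>, so the estimate is uniform up to \<open>t = 0\<close>.\<close>

lemma lipschitz_nonlinearity_scaled:
  assumes f: "lipschitz_nonlinearity L f" and c: "c \<ge> 0"
  shows "\<bar>f (c * v) * v - f (c * w) * w\<bar> \<le> L * \<bar>v - w\<bar>"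
proof (cases "c = 0")
  case True
  have "\<bar>f 0 * (v - w)\<bar> \<le> L * \<bar>v - w\<bar>"
    using f unfolding abs_mult lipschitz_nonlinearity_def by (intro mult_right_mono) auto
  then show ?thesis using True by (simp add: algebra_simps)
next
  case False
  have "\<bar>f (c * v) * (c * v) - f (c * w) * (c * w)\<bar> \<le> L * \<bar>c * v - c * w\<bar>"
    using f unfolding lipschitz_nonlinearity_def by blast
  moreover have "f (c * v) * (c * v) - f (c * w) * (c * w) = c * (f (c * v) * v - f (c * w) * w)"
    "c * v - c * w = c * (v - w)" by (simp_all add: algebra_simps)
  ultimately have "c * \<bar>f (c * v) * v - f (c * w) * w\<bar> \<le> c * (L * \<bar>v - w\<bar>)"
    using c by (simp add: abs_mult mult_ac)
  then show ?thesis using c False by simp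
qed

definition radial_rhs :: "nat \<Rightarrow> (real \<Rightarrow> real) \<Rightarrow> (real \<Rightarrow> real) \<Rightarrow> real \<Rightarrow> real" where
  "radial_rhs m f v = (\<lambda>t. f (t ^ m * v t) * v t)"

lemma continuous_on_radial_rhs:
  assumes "continuous_on UNIV f" "continuous_on S v"
  shows "continuous_on S (radial_rhs m f v)"
  unfolding radial_rhs_def
  by (intro continuous_intros assms continuous_on_compose2[OF assms(1)]) auto

text \<open>Integral form of \<open>v'' + (2 m + 1) / r v' + f (r\<^sup>m v) v = 0\<close>, \<open>v'(0) = 0\<close>, which is
  \<open>(r u')' - m\<^sup>2 / r u + r f(u) u = 0\<close> for \<open>u = r\<^sup>m v\<close>.\<close>

definition radial_sol :: "nat \<Rightarrow> real \<Rightarrow> (real \<Rightarrow> real) \<Rightarrow> (real \<Rightarrow> real) \<Rightarrow> bool" where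
  "radial_sol m R f v \<longleftrightarrow> continuous_on {0..R} v \<and>
     (\<forall>r\<in>{0..R}. v r = v 0 - integral {0..r} (radial_avg (2 * m + 1) (radial_rhs m f v)))"

text \<open>The second integration costs a factor \<open>R\<close>: since \<open>h \<ge> 0\<close>,
  every inner integral is at most the one over \<open>{0..r}\<close>.\<close>

lemma integral_radial_avg_le:
  assumes q: "q \<ge> 1" and g: "continuous_on {0..R} g" and h: "continuous_on {0..R} h"
    and \<epsilon>: "\<epsilon> \<ge> 0" and h0: "\<And>t. t \<in> {0..R} \<Longrightarrow> h t \<ge> 0"
    and le: "\<And>t. t \<in> {0..R} \<Longrightarrow> t * \<bar>g t\<bar> \<le> \<epsilon> + t * h t" and r: "r \<in> {0..R}"
  shows "\<bar>integral {0..r} (radial_avg q g)\<bar> \<le> \<epsilon> * R + R * integral {0..r} h"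
proof -
  have sub: "{0..r} \<subseteq> {0..R}" using r by auto
  have h': "h integrable_on {0..s}" if "s \<le> R" for s
    by (intro integrable_continuous_real continuous_on_subset[OF h]) (use that in auto)
  have J: "integral {0..r} h \<ge> 0" using h' h0 r by (intro integral_nonneg) auto
  have "norm (integral {0..r} (radial_avg q g)) \<le> integral {0..r} (\<lambda>_. \<epsilon> + integral {0..r} h)"
  proof (rule integral_norm_bound_integral)
    show "radial_avg q g integrable_on {0..r}"
      by (intro integrable_continuous_real continuous_on_subset[OF continuous_on_radial_avg[OF q g] sub])
    fix s assume s: "s \<in> {0..r}"
    then have "integral {0..s} h \<le> integral {0..r} h"
      using r h0 by (intro integral_subset_le h') auto
    then show "norm (radial_avg q g s) \<le> \<epsilon> + integral {0..r} h"
      using radial_avg_bound[OF q g h \<epsilon> h0 le, of s] s sub by force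
  qed auto
  then have "\<bar>integral {0..r} (radial_avg q g)\<bar> \<le> r * (\<epsilon> + integral {0..r} h)"
    using r by simp
  also have "\<dots> \<le> R * (\<epsilon> + integral {0..r} h)" using r J \<epsilon> by (intro mult_right_mono) auto
  finally show ?thesis by (simp add: algebra_simps)
qed

lemma radial_sol_exists:
  assumes R: "R > 0" and f: "lipschitz_nonlinearity L f"
  obtains v where "radial_sol m R f v" "v 0 = a"
proof -
  define T where "T v r = a - integral {0..r} (radial_avg (2 * m + 1) (radial_rhs m f v))" for v r
  have fc: "continuous_on UNIV f" and L: "L > 0" using f by (auto simp: lipschitz_nonlinearity_def)
  note c = continuous_on_radial_rhs[OF fc]
  note cavg = continuous_on_radial_avg[OF _ c, of "2 * m + 1"]
  have "\<exists>v. continuous_on {0..R} v \<and> (\<forall>r\<in>{0..R}. v r = T v r)"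
  proof (rule volterra_fixed_point[of R T "R * L"])
    fix v :: "real \<Rightarrow> real" assume v: "continuous_on {0..R} v"
    show "continuous_on {0..R} (T v)" unfolding T_def
      by (intro continuous_intros indefinite_integral_continuous_1 integrable_continuous_real cavg v) auto
    fix w :: "real \<Rightarrow> real" and r assume w: "continuous_on {0..R} w" and r: "r \<in> {0..R}"
    have sub: "{0..r} \<subseteq> {0..R}" using r by auto
    have ig: "radial_avg (2 * m + 1) (radial_rhs m f u) integrable_on {0..r}" if "continuous_on {0..R} u" for u
      by (intro integrable_continuous_real continuous_on_subset[OF _ sub] cavg that) auto
    have "T v r - T w r = - (integral {0..r} (radial_avg (2 * m + 1) (radial_rhs m f v))
        - integral {0..r} (radial_avg (2 * m + 1) (radial_rhs m f w)))" by (simp add: T_def)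
    also have "\<dots> = - integral {0..r} (\<lambda>s. radial_avg (2 * m + 1) (radial_rhs m f v) s
        - radial_avg (2 * m + 1) (radial_rhs m f w) s)"
      by (simp only: integral_diff[OF ig[OF v] ig[OF w]])
    also have "\<dots> = - integral {0..r} (radial_avg (2 * m + 1) (\<lambda>t. radial_rhs m f v t - radial_rhs m f w t))"
      using sub by (intro arg_cong[of _ _ uminus] integral_cong radial_avg_diff[OF c[OF v] c[OF w]]) auto
    finally have "\<bar>T v r - T w r\<bar> =
      \<bar>integral {0..r} (radial_avg (2 * m + 1) (\<lambda>t. radial_rhs m f v t - radial_rhs m f w t))\<bar>" by simp
    also have "\<dots> \<le> 0 * R + R * integral {0..r} (\<lambda>t. L * \<bar>v t - w t\<bar>)"
    proof (rule integral_radial_avg_le[OF _ _ _ _ _ _ r])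
      fix t assume t: "t \<in> {0..R}"
      show "t * \<bar>radial_rhs m f v t - radial_rhs m f w t\<bar> \<le> 0 + t * (L * \<bar>v t - w t\<bar>)"
        using lipschitz_nonlinearity_scaled[OF f, of "t ^ m" "v t" "w t"] t
        by (auto simp: radial_rhs_def intro: mult_left_mono)
    qed (use L in \<open>auto intro!: continuous_intros c v w\<close>)
    finally show "\<bar>T v r - T w r\<bar> \<le> R * L * integral {0..r} (\<lambda>t. \<bar>v t - w t\<bar>)" by simp
  qed (use R L in auto)
  then obtain v where v: "continuous_on {0..R} v" "\<And>r. r \<in> {0..R} \<Longrightarrow> v r = T v r" by blast
  have "v 0 = a" using v(2)[of 0] R by (simp add: T_def)
  then show ?thesis using v by (intro that[of v]) (auto simp: radial_sol_def T_def)
qed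

text \<open>One estimate serves three purposes: dependence on the amplitude (\<open>f = g\<close>,
  \<open>\<epsilon> = 0\<close>), the a priori bound (\<open>w = 0\<close>), and comparison with a
  linearisation (\<open>g\<close> constant). The defect is measured along \<open>v\<close> alone, so
  only \<open>g\<close> has to be Lipschitz.\<close>

lemma radial_sol_perturb:
  assumes R: "R > 0" and v: "radial_sol m R f v" and w: "radial_sol m R g w"
    and f: "continuous_on UNIV f" and g: "lipschitz_nonlinearity L g" and \<epsilon>: "\<epsilon> \<ge> 0"
    and le: "\<And>t. t \<in> {0..R} \<Longrightarrow> t * \<bar>f (t ^ m * v t) * v t - g (t ^ m * v t) * v t\<bar> \<le> \<epsilon>"
    and r: "r \<in> {0..R}"
  shows "\<bar>v r - w r\<bar> \<le> (\<bar>v 0 - w 0\<bar> + \<epsilon> * R) * exp (L * R * R)"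
proof -
  have gc: "continuous_on UNIV g" and L: "L > 0" using g by (auto simp: lipschitz_nonlinearity_def)
  have vc: "continuous_on {0..R} v" and wc: "continuous_on {0..R} w"
    using v w by (auto simp: radial_sol_def)
  note c = continuous_on_radial_rhs[OF f vc] continuous_on_radial_rhs[OF gc wc]
  note cavg = continuous_on_radial_avg[OF _ c(1), of "2 * m + 1"] continuous_on_radial_avg[OF _ c(2), of "2 * m + 1"]
  have "\<bar>v r - w r\<bar> \<le> (\<bar>v 0 - w 0\<bar> + \<epsilon> * R) * exp (L * R * r)"
  proof (rule gronwall_integral[OF _ _ _ r])
    show "continuous_on {0..R} (\<lambda>r. v r - w r)" by (intro continuous_intros vc wc)
    fix r assume r: "r \<in> {0..R}"
    have sub: "{0..r} \<subseteq> {0..R}" using r by auto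
    have "v r - w r = v 0 - w 0 - (integral {0..r} (radial_avg (2 * m + 1) (radial_rhs m f v))
        - integral {0..r} (radial_avg (2 * m + 1) (radial_rhs m g w)))"
      using v w r by (simp add: radial_sol_def algebra_simps)
    also have "integral {0..r} (radial_avg (2 * m + 1) (radial_rhs m f v))
        - integral {0..r} (radial_avg (2 * m + 1) (radial_rhs m g w)) =
        integral {0..r} (\<lambda>s. radial_avg (2 * m + 1) (radial_rhs m f v) s
        - radial_avg (2 * m + 1) (radial_rhs m g w) s)"
      by (intro integral_diff[symmetric] integrable_continuous_real continuous_on_subset[OF _ sub] cavg) auto
    also have "\<dots> = integral {0..r} (radial_avg (2 * m + 1) (\<lambda>t. radial_rhs m f v t - radial_rhs m g w t))"
      using sub by (intro integral_cong radial_avg_diff[OF c]) auto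
    finally have "\<bar>v r - w r\<bar> \<le> \<bar>v 0 - w 0\<bar> +
      \<bar>integral {0..r} (radial_avg (2 * m + 1) (\<lambda>t. radial_rhs m f v t - radial_rhs m g w t))\<bar>" by simp
    also have "\<bar>integral {0..r} (radial_avg (2 * m + 1) (\<lambda>t. radial_rhs m f v t - radial_rhs m g w t))\<bar>
      \<le> \<epsilon> * R + R * integral {0..r} (\<lambda>t. L * \<bar>v t - w t\<bar>)"
    proof (rule integral_radial_avg_le[OF _ _ _ _ _ _ r])
      fix t assume t: "t \<in> {0..R}"
      have "t * \<bar>radial_rhs m f v t - radial_rhs m g w t\<bar> \<le>
        t * (\<bar>f (t ^ m * v t) * v t - g (t ^ m * v t) * v t\<bar>
          + \<bar>g (t ^ m * v t) * v t - g (t ^ m * w t) * w t\<bar>)"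
        using t unfolding radial_rhs_def by (intro mult_left_mono) auto
      also have "\<dots> \<le> \<epsilon> + t * (L * \<bar>v t - w t\<bar>)"
        unfolding distrib_left
        by (intro add_mono mult_left_mono le t lipschitz_nonlinearity_scaled[OF g]) (use t in auto)
      finally show "t * \<bar>radial_rhs m f v t - radial_rhs m g w t\<bar> \<le> \<epsilon> + t * (L * \<bar>v t - w t\<bar>)" .
    qed (use L \<epsilon> in \<open>auto intro!: continuous_intros c vc wc\<close>)
    finally show "\<bar>v r - w r\<bar> \<le> \<bar>v 0 - w 0\<bar> + \<epsilon> * R + L * R * integral {0..r} (\<lambda>t. \<bar>v t - w t\<bar>)"
      by (simp add: mult_ac)
  qed (use R L in auto)
  also have "\<dots> \<le> (\<bar>v 0 - w 0\<bar> + \<epsilon> * R) * exp (L * R * R)"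
    using r R L \<epsilon> by (intro mult_left_mono) auto
  finally show ?thesis .
qed

lemma radial_sol_zero: "radial_sol m R f (\<lambda>_. 0)"
proof -
  have "radial_rhs m f (\<lambda>_. 0) = (\<lambda>_. 0)" "radial_avg q (\<lambda>_. 0) = (\<lambda>_. 0)" for q
    by (auto simp: radial_avg_def radial_rhs_def)
  then show ?thesis unfolding radial_sol_def by (simp only:) simp
qed

lemma radial_sol_deriv:
  assumes v: "radial_sol m R f v" and f: "continuous_on UNIV f" and r: "r \<in> {0..R}"
  shows "(v has_real_derivative - radial_avg (2 * m + 1) (radial_rhs m f v) r) (at r within {0..R})"
proof -
  have vc: "continuous_on {0..R} v" using v by (auto simp: radial_sol_def)
  have "continuous_on {0..R} (radial_avg (2 * m + 1) (radial_rhs m f v))"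
    by (rule continuous_on_radial_avg[OF _ continuous_on_radial_rhs[OF f vc]]) simp
  then have "((\<lambda>r. v 0 - integral {0..r} (radial_avg (2 * m + 1) (radial_rhs m f v))) has_real_derivative
      0 - radial_avg (2 * m + 1) (radial_rhs m f v) r) (at r within {0..R})"
    by (rule DERIV_diff[OF DERIV_const integral_has_real_derivative[OF _ r]])
  then have "((\<lambda>r. v 0 - integral {0..r} (radial_avg (2 * m + 1) (radial_rhs m f v))) has_real_derivative
      - radial_avg (2 * m + 1) (radial_rhs m f v) r) (at r within {0..R})" by simp
  then show ?thesis
    by (rule has_field_derivative_transform_within[OF _ zero_less_one r])
      (use v radial_sol_def in metis)
qed

section \<open>Derivatives, flux and simple zeros of radial solutions\<close>

definition radial_deriv :: "nat \<Rightarrow> (real \<Rightarrow> real) \<Rightarrow> (real \<Rightarrow> real) \<Rightarrow> real \<Rightarrow> real" where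
  "radial_deriv m f v r = - radial_avg (2 * m + 1) (radial_rhs m f v) r"

text \<open>The flux \<open>r u'\<close> of the profile \<open>u = r\<^sup>m v\<close>.\<close>

definition radial_flux :: "nat \<Rightarrow> (real \<Rightarrow> real) \<Rightarrow> (real \<Rightarrow> real) \<Rightarrow> real \<Rightarrow> real" where
  "radial_flux m f v r = r ^ m * (real m * v r + r * radial_deriv m f v r)"

context
  fixes m R f v
  assumes v: "radial_sol m R f v" and f: "continuous_on UNIV f"
begin

lemma radial_sol_continuous: "continuous_on {0..R} v"
  using v by (simp add: radial_sol_def)

lemma continuous_on_radial_deriv: "continuous_on {0..R} (radial_deriv m f v)"
  unfolding radial_deriv_def
  by (intro continuous_on_minus continuous_on_radial_avg continuous_on_radial_rhs[OF f]
      radial_sol_continuous) simp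

lemma radial_sol_has_derivative_within:
  "r \<in> {0..R} \<Longrightarrow> (v has_real_derivative radial_deriv m f v r) (at r within {0..R})"
  unfolding radial_deriv_def by (rule radial_sol_deriv[OF v f])

lemma radial_sol_has_derivative:
  "0 < r \<Longrightarrow> r < R \<Longrightarrow> (v has_real_derivative radial_deriv m f v r) (at r)"
  using radial_sol_has_derivative_within[of r] at_within_Icc_at[of 0 r R] by simp

lemma radial_deriv_has_derivative:
  assumes "0 < r" "r < R"
  shows "(radial_deriv m f v has_real_derivative
    - f (r ^ m * v r) * v r - real (2 * m + 1) / r * radial_deriv m f v r) (at r)"
proof -
  have "((\<lambda>r. - radial_avg (2 * m + 1) (radial_rhs m f v) r) has_real_derivative
    - (radial_rhs m f v r - real (2 * m + 1) / r * radial_avg (2 * m + 1) (radial_rhs m f v) r)) (at r)"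
    by (rule DERIV_minus[OF radial_avg_has_derivative[OF
        continuous_on_radial_rhs[OF f radial_sol_continuous] assms]])
  then show ?thesis by (simp add: radial_deriv_def[abs_def] radial_rhs_def)
qed

lemma continuous_on_radial_flux: "continuous_on {0..R} (radial_flux m f v)"
  unfolding radial_flux_def
  by (intro continuous_intros radial_sol_continuous continuous_on_radial_deriv)

lemma radial_profile_has_derivative:
  assumes "0 < r" "r < R"
  shows "((\<lambda>r. r ^ m * v r) has_real_derivative radial_flux m f v r / r) (at r)"
proof -
  have "real m * r ^ (m - Suc 0) * r = real m * r ^ m" by (cases m) auto
  then show ?thesis using assms
    by (auto intro!: derivative_eq_intros radial_sol_has_derivative simp: radial_flux_def field_simps)
qed

text \<open>The coefficients of \<open>r\<^sup>m v'\<close> add up to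
  \<open>m + m + 1 - (2 m + 1) = 0\<close>; this cancellation is where the exponent
  \<open>2 * m + 1\<close> comes from.\<close>

lemma radial_flux_has_derivative:
  assumes "0 < r" "r < R"
  shows "(radial_flux m f v has_real_derivative
    (real m)\<^sup>2 / r * (r ^ m * v r) - r * f (r ^ m * v r) * (r ^ m * v r)) (at r)"
proof -
  let ?d = "radial_deriv m f v r"
  have e: "real m * r ^ (m - Suc 0) = real m * r ^ m / r" using assms by (cases m) auto
  have "(radial_flux m f v has_real_derivative
      real m * r ^ (m - Suc 0) * (real m * v r + r * ?d) + r ^ m * (real m * ?d + (?d + r *
        (- f (r ^ m * v r) * v r - real (2 * m + 1) / r * ?d)))) (at r)"
    unfolding radial_flux_def
    by (rule derivative_eq_intros refl radial_sol_has_derivative radial_deriv_has_derivative assms)+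
      (simp add: algebra_simps)
  also have "real m * r ^ (m - Suc 0) * (real m * v r + r * ?d) + r ^ m * (real m * ?d + (?d + r *
        (- f (r ^ m * v r) * v r - real (2 * m + 1) / r * ?d))) =
      (real m)\<^sup>2 / r * (r ^ m * v r) - r * f (r ^ m * v r) * (r ^ m * v r)"
    unfolding e using assms by (simp add: field_simps power2_eq_square)
  finally show ?thesis .
qed

text \<open>A zero in the interior would be a double zero, and the energy \<open>v\<^sup>2 + v'\<^sup>2\<close> controls
  itself backwards as long as one stays away from the singular point \<open>0\<close>.\<close>

lemma radial_sol_pos:
  assumes L: "\<And>x. \<bar>f x\<bar> \<le> L" and v0: "v 0 > 0" and nonneg: "\<And>r. r \<in> {0..R} \<Longrightarrow> v r \<ge> 0"
    and \<rho>: "\<rho> \<in> {0..<R}"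
  shows "v \<rho> > 0"
proof (rule ccontr)
  assume "\<not> v \<rho> > 0"
  with nonneg[of \<rho>] \<rho> have z: "v \<rho> = 0" by auto
  with v0 \<rho> have \<rho>0: "0 < \<rho>" "\<rho> < R" by (auto simp: le_less)
  have dz: "radial_deriv m f v \<rho> = 0"
  proof (rule DERIV_local_min[OF radial_sol_has_derivative[OF \<rho>0], of "min \<rho> (R - \<rho>)"])
    show "\<forall>y. \<bar>\<rho> - y\<bar> < min \<rho> (R - \<rho>) \<longrightarrow> v \<rho> \<le> v y"
      using \<rho>0 nonneg z by (auto simp: abs_if split: if_splits)
  qed (use \<rho>0 in auto)
  have "(v \<longlongrightarrow> v 0) (at 0 within {0..R})"
    using radial_sol_continuous \<rho>0 by (auto simp: continuous_on)
  then have "\<forall>\<^sub>F x in at 0 within {0..R}. v x > 0" by (rule order_tendstoD) (rule v0)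
  then obtain d where d: "d > 0" "\<And>x. x \<in> {0..R} \<Longrightarrow> x \<noteq> 0 \<Longrightarrow> dist x 0 < d \<Longrightarrow> v x > 0"
    unfolding eventually_at by blast
  define e where "e = min d \<rho> / 2"
  have e: "0 < e" "e < \<rho>" "e < d" using d \<rho>0 by (auto simp: e_def min_def)
  have ve: "v e > 0" using d(2)[of e] e \<rho>0 by auto
  \<comment> \<open>Chosen to make \<open>P\<close> nondecreasing on \<open>[e, \<rho>]\<close>: 1
    absorbs the product \<open>2 v v'\<close>, \<open>L\<close> the term with \<open>f\<close>, and
    the last summand the first-order term, whose coefficient is at most \<open>(2 m + 1) / e\<close>
    there.\<close>
  define C where "C = 1 + L + 2 * (real (2 * m + 1) / e)"
  define P where "P = (\<lambda>r. ((v r)\<^sup>2 + (radial_deriv m f v r)\<^sup>2) * exp (C * r))"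
  have "P e \<le> P \<rho>"
  proof (rule DERIV_nonneg_imp_nondecreasing[where f = P])
    show "e \<le> \<rho>" using e by simp
    fix r assume r: "e \<le> r" "r \<le> \<rho>"
    then have r0: "0 < r" "r < R" using e \<rho>0 by auto
    define x y F where "x = v r" and "y = radial_deriv m f v r" and "F = f (r ^ m * v r)"
    have "(P has_real_derivative (2 * x * y + 2 * y * (- F * x - real (2 * m + 1) / r * y)
        + C * (x\<^sup>2 + y\<^sup>2)) * exp (C * r)) (at r)"
      unfolding P_def x_def y_def F_def
      by (rule derivative_eq_intros refl radial_sol_has_derivative radial_deriv_has_derivative r0)+
        (simp add: algebra_simps)
    moreover have "2 * x * y + 2 * y * (- F * x - real (2 * m + 1) / r * y) + C * (x\<^sup>2 + y\<^sup>2) \<ge> 0"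
    proof -
      have "0 \<le> (x + y)\<^sup>2" by simp
      then have 1: "2 * x * y + (x\<^sup>2 + y\<^sup>2) \<ge> 0" by (simp add: power2_sum)
      have "2 * \<bar>x * y\<bar> \<le> x\<^sup>2 + y\<^sup>2" using 1 sum_squares_bound[of x y] by (simp add: abs_if)
      then have "\<bar>F\<bar> * (2 * \<bar>x * y\<bar>) \<le> L * (x\<^sup>2 + y\<^sup>2)"
        using L[of "r ^ m * v r"] by (intro mult_mono) (auto simp: F_def)
      then have 2: "L * (x\<^sup>2 + y\<^sup>2) + 2 * y * (- F * x) \<ge> 0"
        using abs_ge_self[of "2 * y * (F * x)"] by (simp add: abs_mult mult_ac)
      have "real (2 * m + 1) / r \<le> real (2 * m + 1) / e" using r e by (intro divide_left_mono) auto
      then have yy: "real (2 * m + 1) / r * y\<^sup>2 \<le> real (2 * m + 1) / e * (x\<^sup>2 + y\<^sup>2)"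
        using e by (intro mult_mono) auto
      have e3: "2 * b * c - 2 * y * (a * y) = 2 * (b * c - a * y\<^sup>2)" for a b c
        by (simp add: power2_eq_square algebra_simps)
      have 3: "2 * (real (2 * m + 1) / e) * (x\<^sup>2 + y\<^sup>2) - 2 * y * (real (2 * m + 1) / r * y) \<ge> 0"
        unfolding e3 by (rule mult_nonneg_nonneg) (simp, simp only: diff_ge_0_iff_ge yy)
      have "a + (b - c) + (1 * d + g + h) = (a + d) + (g + b) + (h - c)" for a b c d g h :: real by simp
      then show ?thesis unfolding C_def
        by (simp only: distrib_right right_diff_distrib) (intro add_nonneg_nonneg 1 2 3)
    qed
    ultimately show "\<exists>y. (P has_real_derivative y) (at r) \<and> 0 \<le> y"
      using mult_nonneg_nonneg exp_ge_zero by blast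
  qed
  then have "(v e)\<^sup>2 + (radial_deriv m f v e)\<^sup>2 \<le> 0" using z dz by (simp add: P_def mult_le_0_iff)
  then show False using ve by (simp add: sum_power2_le_zero_iff)
qed

end

section \<open>First zeros and the Picone bound\<close>

text \<open>The compact set where \<open>f \<le> 0\<close> has a least element, and the intermediate
  value theorem gives a zero no later than it.\<close>

lemma first_zero:
  fixes f :: "real \<Rightarrow> real"
  assumes f: "continuous_on {0..R} f" and 0: "f 0 > 0" and s: "s \<in> {0..R}" "f s \<le> 0"
  obtains \<rho> where "0 < \<rho>" "\<rho> \<le> R" "f \<rho> = 0" "\<And>t. 0 \<le> t \<Longrightarrow> t < \<rho> \<Longrightarrow> f t > 0"
proof -
  have "closed {t \<in> {0..R}. f t \<le> 0}"
    by (intro continuous_on_closed_Collect_le f continuous_intros)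
  then have "compact ({0..R} \<inter> {t \<in> {0..R}. f t \<le> 0})"
    by (intro compact_Int_closed) auto
  moreover have "{0..R} \<inter> {t \<in> {0..R}. f t \<le> 0} \<noteq> {}" using s by blast
  ultimately have "\<exists>\<rho>\<in>{0..R} \<inter> {t \<in> {0..R}. f t \<le> 0}. \<forall>t\<in>{0..R} \<inter> {t \<in> {0..R}. f t \<le> 0}. \<rho> \<le> t"
    by (rule compact_attains_inf)
  then obtain \<rho> where \<rho>: "0 \<le> \<rho>" "\<rho> \<le> R" "f \<rho> \<le> 0"
    and least: "\<And>t. 0 \<le> t \<Longrightarrow> t \<le> R \<Longrightarrow> f t \<le> 0 \<Longrightarrow> \<rho> \<le> t"
    by auto
  obtain x where x: "0 \<le> x" "x \<le> \<rho>" "f x = 0"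
    using IVT2'[of f \<rho> 0 0] \<rho> 0 continuous_on_subset[OF f, of "{0..\<rho>}"] by auto
  then have "\<rho> = x" using least[of x] \<rho> by auto
  moreover have "f t > 0" if "0 \<le> t" "t < \<rho>" for t
    using least[of t] that \<rho> by (cases "f t \<le> 0") auto
  ultimately show ?thesis using that[of \<rho>] x 0 \<rho> by (cases "\<rho> = 0") auto
qed

text \<open>Riccati form of the Picone inequality: with \<open>p = r u' / u\<close>, the derivative of \<open>\<phi>\<^sup>2 p\<close>
  is at most \<open>r \<phi>'\<^sup>2 + m\<^sup>2 \<phi>\<^sup>2 / r - \<mu> r \<phi>\<^sup>2\<close>; here \<open>\<phi>\<close> is the tent function on \<open>[0, S]\<close>.\<close>

lemma radial_sol_linear_nonneg_bound:
  assumes v: "radial_sol m R (\<lambda>_. \<mu>) v" and v0: "v 0 > 0"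
    and nonneg: "\<And>r. r \<in> {0..R} \<Longrightarrow> v r \<ge> 0" and S: "0 < S" "S < R"
  shows "\<mu> * S\<^sup>2 \<le> 12 * (1 + (real m)\<^sup>2 * (2 * ln 2 - 1))"
proof -
  note vc = v continuous_on_const
  \<comment> \<open>\<open>S < R\<close> keeps the closed interval away from \<open>R\<close>, where
    \<open>v\<close> may vanish; so the quotient in \<open>p\<close> is continuous on all of
    \<open>[0, S]\<close>.\<close>
  have pos: "v r > 0" if "r \<in> {0..S}" for r
    by (rule radial_sol_pos[OF vc, of "\<bar>\<mu>\<bar>"]) (use v0 nonneg S that in auto)
  define d where "d = radial_deriv m (\<lambda>_. \<mu>) v"
  \<comment> \<open>This is \<open>r u' / u\<close> for \<open>u = r\<^sup>m v\<close>. In terms of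
    \<open>v\<close> it is continuous at 0, with value \<open>m\<close>.\<close>
  define p where "p = (\<lambda>r. real m + r * d r / v r)"
  have pc: "continuous_on {0..S} p" unfolding p_def d_def
    using pos S
    by (intro continuous_intros continuous_on_subset[OF continuous_on_radial_deriv[OF vc]]
        continuous_on_subset[OF radial_sol_continuous[OF vc]]) force+
  have dp: "(p has_real_derivative (real m)\<^sup>2 / r - r * \<mu> - (p r)\<^sup>2 / r) (at r)" if r: "0 < r" "r < S" for r
  proof -
    have r': "0 < r" "r < R" using r S by auto
    have vp: "v r > 0" using pos r by auto
    have "(p has_real_derivative ((1 * d r + (- \<mu> * v r - real (2 * m + 1) / r * d r) * r) * v r
        - r * d r * d r) / (v r * v r)) (at r)"
      unfolding p_def d_def
      by (rule derivative_eq_intros refl radial_sol_has_derivative[OF vc] radial_deriv_has_derivative[OF vc] r')+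
        (use vp in auto)
    also have "((1 * d r + (- \<mu> * v r - real (2 * m + 1) / r * d r) * r) * v r
        - r * d r * d r) / (v r * v r) = (real m)\<^sup>2 / r - r * \<mu> - (p r)\<^sup>2 / r"
      using r vp by (simp add: p_def field_simps power2_eq_square)
    finally show ?thesis .
  qed
  \<comment> \<open>Antiderivative of the Picone bound for the rising half \<open>\<phi> = r\<close>
    of the tent. The gap between the two derivatives is a completed square, which gives
    \<open>A1' \<le> 0\<close>.\<close>
  define G1 where "G1 = (\<lambda>r. (1 + (real m)\<^sup>2) * r\<^sup>2 / 2 - \<mu> * r ^ 4 / 4)"
  define A1 where "A1 = (\<lambda>r. r\<^sup>2 * p r - G1 r)"
  have dG1: "(G1 has_real_derivative r + (real m)\<^sup>2 * r - \<mu> * r ^ 3) (at r)" for r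
    unfolding G1_def by (auto intro!: derivative_eq_intros simp: field_simps)
  have "A1 (S / 2) \<le> A1 0"
  proof (rule DERIV_nonpos_imp_decreasing_open[where f = A1])
    fix r assume r: "0 < r" "r < S / 2"
    then have r': "0 < r" "r < S" by auto
    have "(A1 has_real_derivative - (r * (p r - 1)\<^sup>2)) (at r)"
      unfolding A1_def
      by (rule derivative_eq_intros refl dp[OF r'] dG1)+
        (use r S in \<open>auto simp: field_simps power2_eq_square power3_eq_cube\<close>)
    then show "\<exists>y. (A1 has_real_derivative y) (at r) \<and> y \<le> 0" using r by (intro exI conjI) auto
  qed (use S in \<open>auto simp: A1_def G1_def intro!: continuous_intros continuous_on_subset[OF pc]\<close>)
  then have 1: "(S / 2)\<^sup>2 * p (S / 2) \<le> G1 (S / 2)" by (simp add: A1_def G1_def)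
  \<comment> \<open>The same for the falling half \<open>\<phi> = S - r\<close>, where
    \<open>\<phi>' = -1\<close> gives the square of \<open>(S - r) p + r\<close>.\<close>
  define G2 where "G2 = (\<lambda>r. r\<^sup>2 / 2 + (real m)\<^sup>2 * (S\<^sup>2 * ln r - 2 * S * r + r\<^sup>2 / 2)
    - \<mu> * (S\<^sup>2 * r\<^sup>2 / 2 - 2 * S * r ^ 3 / 3 + r ^ 4 / 4))"
  define A2 where "A2 = (\<lambda>r. (S - r)\<^sup>2 * p r - G2 r)"
  have dG2: "(G2 has_real_derivative r + (real m)\<^sup>2 * (S - r)\<^sup>2 / r - \<mu> * r * (S - r)\<^sup>2) (at r)"
    if "r > 0" for r
    unfolding G2_def using that
    by (auto intro!: derivative_eq_intros simp: field_simps power2_eq_square power3_eq_cube)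
  have "A2 S \<le> A2 (S / 2)"
  proof (rule DERIV_nonpos_imp_decreasing_open[where f = A2])
    fix r assume r: "S / 2 < r" "r < S"
    then have r0: "r > 0" using S by auto
    have "(A2 has_real_derivative - (((S - r) * p r + r)\<^sup>2 / r)) (at r)"
      unfolding A2_def
      by (rule derivative_eq_intros refl dp[OF r0 r(2)] dG2[OF r0])+
        (use r r0 S in \<open>auto simp: field_simps power2_eq_square\<close>)
    then show "\<exists>y. (A2 has_real_derivative y) (at r) \<and> y \<le> 0" using r0 by (intro exI conjI) auto
  qed (use S in \<open>auto simp: A2_def G2_def intro!: continuous_intros continuous_on_subset[OF pc]\<close>)
  then have "- G2 S \<le> G1 (S / 2) - G2 (S / 2)" using 1 by (simp add: A2_def power2_eq_square)
  \<comment> \<open>The tent has \<open>\<integral> r \<phi>'\<^sup>2 = S\<^sup>2 / 2\<close>,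
    \<open>\<integral> \<phi>\<^sup>2 / r = S\<^sup>2 (ln 2 - 1/2)\<close> and
    \<open>\<integral> r \<phi>\<^sup>2 = S\<^sup>4 / 24\<close>; their ratio produces the constant
    12.\<close>
  also have "G1 (S / 2) - G2 (S / 2) = - G2 S + S\<^sup>2 / 2 + (real m)\<^sup>2 * S\<^sup>2 * (ln 2 - 1 / 2) - \<mu> * S ^ 4 / 24"
    using S by (simp add: G1_def G2_def ln_div field_simps power2_eq_square power4_eq_xxxx eval_nat_numeral)
  finally have "S\<^sup>2 * (\<mu> * S\<^sup>2) \<le> S\<^sup>2 * (12 * (1 + (real m)\<^sup>2 * (2 * ln 2 - 1)))"
    by (simp add: algebra_simps power2_eq_square power4_eq_xxxx)
  then show ?thesis using S by (simp add: mult_le_cancel_left)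
qed

subsection \<open>The Bessel function and the linearisation at zero\<close>

definition bessel_series :: "real \<Rightarrow> real" where
  "bessel_series t = (\<Sum>k. (-1) ^ k / (fact k)\<^sup>2 * t ^ k)"

text \<open>This is \<open>t\<close> times the derivative of \<open>bessel_series\<close>. In the
  variable \<open>t = x\<^sup>2 / 4\<close> Bessel's equation for \<open>J\<^sub>0\<close> becomes
  \<open>(t B')' = - B\<close>, a first-order system for this pair.\<close>

definition bessel_flux :: "real \<Rightarrow> real" where
  "bessel_flux t = (\<Sum>k. (real k * ((-1) ^ k / (fact k)\<^sup>2)) * t ^ k)"

lemma bessel_J0_eq: "bessel_J0 x = bessel_series (x\<^sup>2 / 4)"
  unfolding bessel_J0_def bessel_series_def
  by (intro suminf_cong) (simp add: power_mult power_divide power2_eq_square)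

lemma bessel_coeff_le: "real k / (fact k)\<^sup>2 \<le> 1 / (fact k :: real)"
proof -
  have "real k \<le> fact k" by (metis fact_ge_self of_nat_fact of_nat_mono)
  then show ?thesis by (simp add: power2_eq_square field_simps)
qed

lemma summable_bessel_flux: "summable (\<lambda>k. (real k * ((-1) ^ k / (fact k)\<^sup>2)) * (t::real) ^ k)"
proof (rule summable_comparison_test'[where N = 0])
  show "summable (\<lambda>k. inverse (fact k) * \<bar>t\<bar> ^ k)" by (rule summable_exp)
  show "norm ((real k * ((-1) ^ k / (fact k)\<^sup>2)) * t ^ k) \<le> inverse (fact k) * \<bar>t\<bar> ^ k" for k
    using mult_right_mono[OF bessel_coeff_le, of "\<bar>t\<bar> ^ k" k]
    by (simp add: abs_mult power_abs inverse_eq_divide)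
qed

lemma summable_bessel_series: "summable (\<lambda>k. (-1) ^ k / (fact k)\<^sup>2 * (t::real) ^ k)"
proof (rule summable_comparison_test'[where N = 0])
  show "summable (\<lambda>k. inverse (fact k) * \<bar>t\<bar> ^ k)" by (rule summable_exp)
  have "1 / (fact k)\<^sup>2 \<le> 1 / (fact k :: real)" for k
    by (simp add: power2_eq_square field_simps)
  from mult_right_mono[OF this, of "\<bar>t\<bar> ^ k" for k]
  show "norm ((-1) ^ k / (fact k)\<^sup>2 * t ^ k) \<le> inverse (fact k) * \<bar>t\<bar> ^ k" for k
    by (simp add: abs_mult power_abs inverse_eq_divide)
qed

lemma bessel_series_deriv:
  assumes "t \<noteq> 0"
  shows "(bessel_series has_real_derivative bessel_flux t / t) (at t)"
proof -
  let ?c = "\<lambda>k. (-1) ^ k / (fact k)\<^sup>2 :: real"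
  have "(bessel_series has_real_derivative (\<Sum>k. diffs ?c k * t ^ k)) (at t)"
    unfolding bessel_series_def[abs_def]
    by (rule termdiffs_strong_converges_everywhere) (rule summable_bessel_series)
  moreover have "bessel_flux t = t * (\<Sum>k. diffs ?c k * t ^ k)"
  proof -
    have "bessel_flux t = (\<Sum>k. (real (Suc k) * ?c (Suc k)) * t ^ Suc k)"
      unfolding bessel_flux_def
      by (subst suminf_split_head[OF summable_bessel_flux]) simp
    also have "\<dots> = (\<Sum>k. t * (diffs ?c k * t ^ k))"
      by (intro suminf_cong) (simp add: diffs_def)
    also have "\<dots> = t * (\<Sum>k. diffs ?c k * t ^ k)"
      by (rule suminf_mult[OF termdiff_converges_all]) (rule summable_bessel_series)
    finally show ?thesis .
  qed
  ultimately show ?thesis using assms by simp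
qed

lemma bessel_flux_deriv: "(bessel_flux has_real_derivative - bessel_series t) (at t)"
proof -
  let ?c = "\<lambda>k. (real k * ((-1) ^ k / (fact k)\<^sup>2)) :: real"
  have "(bessel_flux has_real_derivative (\<Sum>k. diffs ?c k * t ^ k)) (at t)"
    unfolding bessel_flux_def[abs_def]
    by (rule termdiffs_strong_converges_everywhere) (rule summable_bessel_flux)
  also have "(\<Sum>k. diffs ?c k * t ^ k) = (\<Sum>k. - ((-1) ^ k / (fact k)\<^sup>2 * t ^ k))"
  proof (intro suminf_cong)
    fix k
    have "real (Suc k) * (real (Suc k) * (1 / (fact (Suc k))\<^sup>2)) = 1 / (fact k)\<^sup>2"
      by (simp add: power2_eq_square field_simps del: of_nat_Suc)
    then have "(- ((-1) ^ k)) * (real (Suc k) * (real (Suc k) * (1 / (fact (Suc k))\<^sup>2))) = (- ((-1) ^ k)) * (1 / (fact k)\<^sup>2)"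
      by (rule arg_cong)
    then have "diffs ?c k = - ((-1) ^ k / (fact k)\<^sup>2)"
      by (simp add: diffs_def mult_ac del: of_nat_Suc fact_Suc)
    then show "diffs ?c k * t ^ k = - ((-1) ^ k / (fact k)\<^sup>2 * t ^ k)" by simp
  qed
  also have "\<dots> = - bessel_series t"
    unfolding bessel_series_def by (rule suminf_minus[OF summable_bessel_series])
  finally show ?thesis .
qed

lemma continuous_on_bessel_series: "continuous_on S bessel_series"
proof -
  have "isCont bessel_series t" for t unfolding bessel_series_def[abs_def]
    by (rule isCont_powser_converges_everywhere) (rule summable_bessel_series)
  then show ?thesis by (simp add: continuous_at_imp_continuous_on)
qed

lemma continuous_on_bessel_flux: "continuous_on S bessel_flux"
  using bessel_flux_deriv by (intro DERIV_continuous_on[of _ _ "\<lambda>t. - bessel_series t"])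
    (blast intro: has_field_derivative_at_within)

lemma bessel_series_0: "bessel_series 0 = 1"
  unfolding bessel_series_def by (subst powser_zero) simp

text \<open>The point 2 corresponds to \<open>x = sqrt 8\<close>, just beyond the first zero. The
  first four terms sum to -2/9, and the remaining ones are dominated by a geometric series of sum
  1/18.\<close>

lemma bessel_series_2_neg: "bessel_series 2 < 0"
proof -
  let ?a = "\<lambda>k. (-1) ^ k / (fact k)\<^sup>2 * 2 ^ k :: real"
  have "2 ^ (k + 4) / (fact (k + 4))\<^sup>2 \<le> (1 / 36) * (1 / 2 :: real) ^ k" for k
  proof (induction k)
    case 0 then show ?case by (simp add: fact_numeral)
  next
    case (Suc k)
    have "2 / (real (k + 5))\<^sup>2 \<le> 2 / (5::real)\<^sup>2" by (intro divide_left_mono power_mono) auto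
    also have "\<dots> \<le> 1 / 2" by simp
    finally have 1: "2 / (real (k + 5))\<^sup>2 \<le> 1 / 2" .
    have "fact (Suc k + 4) = real (k + 5) * fact (k + 4)"
      by (simp add: fact_reduce algebra_simps)
    moreover have "2 ^ (Suc k + 4) = 2 * (2::real) ^ (k + 4)" by (metis add_Suc power_Suc)
    ultimately have "2 ^ (Suc k + 4) / (fact (Suc k + 4))\<^sup>2 = 2 / (real (k + 5))\<^sup>2 * (2 ^ (k + 4) / (fact (k + 4))\<^sup>2)"
      by (simp only: power_mult_distrib times_divide_times_eq)
    also have "\<dots> \<le> 1 / 2 * ((1 / 36) * (1 / 2 :: real) ^ k)"
      by (intro mult_mono 1 Suc) auto
    finally show ?case by simp
  qed
  then have le: "?a (k + 4) \<le> (1 / 36) * (1 / 2 :: real) ^ k" for k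
  proof -
    have "?a (k + 4) \<le> \<bar>?a (k + 4)\<bar>" by (rule abs_ge_self)
    also have "\<dots> = 2 ^ (k + 4) / (fact (k + 4))\<^sup>2"
      by (simp add: abs_mult)
    finally show ?thesis using \<open>\<And>k. 2 ^ (k + 4) / (fact (k + 4))\<^sup>2 \<le> (1 / 36) * (1 / 2 :: real) ^ k\<close>[of k] by linarith
  qed
  have "bessel_series 2 = (\<Sum>k. ?a (k + 4)) + (\<Sum>k<4. ?a k)"
    unfolding bessel_series_def by (rule suminf_split_initial_segment[OF summable_bessel_series])
  also have "(\<Sum>k<4. ?a k) = - (2 / 9)"
    by (simp add: eval_nat_numeral fact_numeral)
  also have "(\<Sum>k. ?a (k + 4)) \<le> (\<Sum>k. (1 / 36) * (1 / 2 :: real) ^ k)"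
    by (intro suminf_le le summable_mult summable_geometric
        summable_ignore_initial_segment[OF summable_bessel_series[of 2]]) simp
  also have "\<dots> = 1 / 36 * 2"
    by (subst suminf_mult) (auto simp: suminf_geometric)
  finally show ?thesis by simp
qed

text \<open>The definite description in \<open>r0\<close> can be evaluated once a least positive
  zero exists; the sign change between 0 and \<open>sqrt 8\<close> provides it.\<close>

lemma r0_props: "r0 > 0" "bessel_J0 r0 = 0" "0 \<le> s \<Longrightarrow> s < r0 \<Longrightarrow> bessel_J0 s > 0"
proof -
  have "continuous_on {0..sqrt 8} bessel_J0" unfolding bessel_J0_eq[abs_def]
    by (intro continuous_on_compose2[OF continuous_on_bessel_series[of UNIV]] continuous_intros) auto
  moreover have "bessel_J0 0 > 0" "bessel_J0 (sqrt 8) \<le> 0"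
    using bessel_series_2_neg by (simp_all add: bessel_J0_eq bessel_series_0)
  ultimately obtain \<rho> where \<rho>: "0 < \<rho>" "bessel_J0 \<rho> = 0" "\<And>t. 0 \<le> t \<Longrightarrow> t < \<rho> \<Longrightarrow> bessel_J0 t > 0"
    using first_zero[of "sqrt 8" bessel_J0 "sqrt 8"] by auto
  have "r0 = \<rho>" unfolding r0_def
  proof (rule the_equality)
    show "\<rho> > 0 \<and> bessel_J0 \<rho> = 0 \<and> (\<forall>s. 0 < s \<and> s < \<rho> \<longrightarrow> bessel_J0 s \<noteq> 0)"
      using \<rho> by (auto simp: less_imp_neq[THEN not_sym])
    fix r assume "r > 0 \<and> bessel_J0 r = 0 \<and> (\<forall>s. 0 < s \<and> s < r \<longrightarrow> bessel_J0 s \<noteq> 0)"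
    then show "r = \<rho>" using \<rho> by (metis less_irrefl linorder_neqE_linordered_idom less_imp_le)
  qed
  with \<rho> show "r0 > 0" "bessel_J0 r0 = 0" "0 \<le> s \<Longrightarrow> s < r0 \<Longrightarrow> bessel_J0 s > 0" by auto
qed

text \<open>Sturm comparison with \<open>J\<^sub>0(r\<^sub>0 r / R)\<close>: at a first zero \<open>\<rho>\<close> the Wronskian would be positive
  by integration and nonpositive by inspection.\<close>

lemma radial_sol_linear_pos:
  assumes R: "R > 0" and m: "m \<ge> 1" and y: "radial_sol m R (\<lambda>_. \<nu>) y" and y0: "y 0 > 0"
    and \<nu>: "\<nu> * R\<^sup>2 < (real m)\<^sup>2 + r0\<^sup>2" and r: "r \<in> {0..R}"
  shows "y r > 0"
proof (rule ccontr)
  assume "\<not> y r > 0"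
  note yc = y continuous_on_const
  obtain \<rho> where \<rho>: "0 < \<rho>" "\<rho> \<le> R" "y \<rho> = 0" "\<And>t. 0 \<le> t \<Longrightarrow> t < \<rho> \<Longrightarrow> y t > 0"
    using first_zero[OF radial_sol_continuous[OF yc] y0 r] \<open>\<not> y r > 0\<close> by auto
  \<comment> \<open>\<open>J\<close> is \<open>J\<^sub>0(r\<^sub>0 r / R)\<close>, which first
    vanishes at \<open>R\<close>, and \<open>Q = r J'\<close> because
    \<open>r d/dr = 2 t d/dt\<close> for \<open>t = \<beta> r\<^sup>2 / 4\<close>. Hence
    \<open>Q' = - \<beta> r J\<close>.\<close>
  define \<beta> where "\<beta> = (r0 / R)\<^sup>2"
  define J where "J = (\<lambda>r. bessel_series (\<beta> * r\<^sup>2 / 4))"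
  define Q where "Q = (\<lambda>r. 2 * bessel_flux (\<beta> * r\<^sup>2 / 4))"
  have \<beta>: "\<beta> > 0" using r0_props(1) R by (simp add: \<beta>_def)
  have J_eq: "J r = bessel_J0 (r0 * r / R)" for r
    by (simp add: J_def \<beta>_def bessel_J0_eq power_mult_distrib power_divide)
  have Jpos: "J r > 0" if "0 \<le> r" "r < R" for r
    unfolding J_eq using that R r0_props(1) by (intro r0_props) (auto simp: field_simps)
  have "J R = 0" using R r0_props(2) by (simp add: J_eq)
  then have J\<rho>: "J \<rho> \<ge> 0" using Jpos[of \<rho>] \<rho> by (cases "\<rho> = R") auto
  have dJ: "(J has_real_derivative Q r / r) (at r)" if "r > 0" for r
  proof -
    have "((\<lambda>r. \<beta> * r\<^sup>2 / 4) has_real_derivative \<beta> * r / 2) (at r)"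
      by (auto intro!: derivative_eq_intros)
    from DERIV_chain2[OF bessel_series_deriv this] that \<beta> show ?thesis
      by (simp add: J_def Q_def field_simps power2_eq_square)
  qed
  have dQ: "(Q has_real_derivative - \<beta> * r * J r) (at r)" for r
  proof -
    have "((\<lambda>r. \<beta> * r\<^sup>2 / 4) has_real_derivative \<beta> * r / 2) (at r)"
      by (auto intro!: derivative_eq_intros)
    from DERIV_cmult[OF DERIV_chain2[OF bessel_flux_deriv this], of 2] show ?thesis
      by (simp add: J_def Q_def field_simps power2_eq_square)
  qed
  have cJ: "continuous_on S J" "continuous_on S Q" for S unfolding J_def Q_def
    by (intro continuous_intros continuous_on_compose2[OF continuous_on_bessel_series[of UNIV]]
      continuous_on_compose2[OF continuous_on_bessel_flux[of UNIV]]; simp)+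
  define u where "u = (\<lambda>r. r ^ m * y r)"
  define w where "w = radial_flux m (\<lambda>_. \<nu>) y"
  define W where "W = (\<lambda>r. w r * J r - u r * Q r)"
  have sub: "{0..\<rho>} \<subseteq> {0..R}" using \<rho> by auto
  have "W 0 < W \<rho>"
  proof (rule DERIV_pos_imp_increasing_open[OF \<rho>(1), where f = W])
    fix r assume r: "0 < r" "r < \<rho>"
    then have r': "0 < r" "r < R" using \<rho> by auto
    have "(W has_real_derivative ((real m)\<^sup>2 / r * u r - r * \<nu> * u r) * J r + Q r / r * w r
        - (w r / r * Q r + (- \<beta> * r * J r) * u r)) (at r)"
      unfolding W_def u_def w_def
      by (intro DERIV_diff DERIV_mult radial_flux_has_derivative[OF yc r']
          radial_profile_has_derivative[OF yc r'] dJ dQ r')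
    also have "((real m)\<^sup>2 / r * u r - r * \<nu> * u r) * J r + Q r / r * w r
        - (w r / r * Q r + (- \<beta> * r * J r) * u r) = u r * J r * (((real m)\<^sup>2 + \<beta> * r\<^sup>2) - \<nu> * r\<^sup>2) / r"
      using r by (simp add: field_simps power2_eq_square)
    finally have D: "(W has_real_derivative u r * J r * (((real m)\<^sup>2 + \<beta> * r\<^sup>2) - \<nu> * r\<^sup>2) / r) (at r)" .
    \<comment> \<open>The hypothesis on \<nu>, rewritten with
      \<open>\<beta> R\<^sup>2 = r0\<^sup>2\<close>. It passes to all smaller \<open>r\<close> since
      \<open>(\<nu> - \<beta>) r\<^sup>2\<close> is either negative or nondecreasing in
      \<open>r\<close>.\<close>
    have "(\<nu> - \<beta>) * R\<^sup>2 < (real m)\<^sup>2" 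
      using \<nu> R by (simp add: \<beta>_def power_divide left_diff_distrib)
    have "(\<nu> - \<beta>) * r\<^sup>2 < (real m)\<^sup>2"
    proof (cases "\<nu> - \<beta> \<ge> 0")
      case True
      have "(\<nu> - \<beta>) * r\<^sup>2 \<le> (\<nu> - \<beta>) * R\<^sup>2" using True r' by (intro mult_left_mono power_mono) auto
      then show ?thesis using \<open>(\<nu> - \<beta>) * R\<^sup>2 < (real m)\<^sup>2\<close> by linarith
    next
      case False
      then have "(\<nu> - \<beta>) * r\<^sup>2 < 0" using r by (intro mult_neg_pos) auto
      then show ?thesis using zero_le_power2[of "real m"] by linarith
    qed
    then have "((real m)\<^sup>2 + \<beta> * r\<^sup>2) - \<nu> * r\<^sup>2 > 0" by (simp add: algebra_simps)
    moreover have "u r > 0" "J r > 0" using \<rho>(4)[of r] Jpos[of r] r r' by (auto simp: u_def)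
    ultimately have "u r * J r * (((real m)\<^sup>2 + \<beta> * r\<^sup>2) - \<nu> * r\<^sup>2) / r > 0"
      using r by (intro divide_pos_pos mult_pos_pos)
    with D show "\<exists>y. (W has_real_derivative y) (at r) \<and> y > 0" by blast
  next
    show "continuous_on {0..\<rho>} W" unfolding W_def u_def w_def
      by (intro continuous_intros cJ continuous_on_subset[OF radial_sol_continuous[OF yc] sub]
          continuous_on_subset[OF continuous_on_radial_flux[OF yc] sub])
  qed
  moreover have "W 0 = 0" using m by (simp add: W_def u_def w_def radial_flux_def)
  \<comment> \<open>At \<rho> the Wronskian reduces to the term with \<open>y'\<close>, as
    \<open>y \<rho> = 0\<close>. Since \<open>\<rho> = R\<close> is possible, the sign of
    \<open>y'\<close> is read off from points to the left.\<close>
  moreover have "radial_deriv m (\<lambda>_. \<nu>) y \<rho> \<le> 0"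
  proof (rule ccontr)
    assume "\<not> radial_deriv m (\<lambda>_. \<nu>) y \<rho> \<le> 0"
    moreover have "(y has_real_derivative radial_deriv m (\<lambda>_. \<nu>) y \<rho>) (at \<rho> within {0..R})"
      using radial_sol_has_derivative_within[OF yc, of \<rho>] \<rho> by simp
    ultimately obtain d where d: "d > 0" "\<And>h. h > 0 \<Longrightarrow> \<rho> - h \<in> {0..R} \<Longrightarrow> h < d \<Longrightarrow> y (\<rho> - h) < y \<rho>"
      using has_real_derivative_pos_inc_left[of y _ \<rho> "{0..R}"] by force
    define h where "h = min d \<rho> / 2"
    have "h > 0" "h < d" "h < \<rho>" using d \<rho> by (auto simp: h_def min_def)
    then show False using d(2)[of h] \<rho>(2,3) \<rho>(4)[of "\<rho> - h"] by auto
  qed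
  then have "\<rho> ^ m * (\<rho> * radial_deriv m (\<lambda>_. \<nu>) y \<rho>) * J \<rho> \<le> 0"
    using J\<rho> \<rho>(1) by (intro mult_nonpos_nonneg mult_nonneg_nonpos) auto
  then have "W \<rho> \<le> 0" using \<rho>(3) by (simp add: W_def u_def w_def radial_flux_def)
  ultimately show False by linarith
qed

subsection \<open>The saturable nonlinearity\<close>

lemma lipschitz_nonlinearity_const: "lipschitz_nonlinearity (\<bar>\<mu>\<bar> + 1) (\<lambda>_. \<mu>)"
proof -
  have "\<bar>\<mu> * x - \<mu> * y\<bar> \<le> (\<bar>\<mu>\<bar> + 1) * \<bar>x - y\<bar>" for x y
  proof -
    have "\<bar>\<mu> * x - \<mu> * y\<bar> = \<bar>\<mu>\<bar> * \<bar>x - y\<bar>" by (simp flip: abs_mult add: right_diff_distrib)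
    then show ?thesis by (simp add: distrib_right)
  qed
  then show ?thesis by (auto simp: lipschitz_nonlinearity_def)
qed

text \<open>The splitting \<open>2 x\<^sup>2 / (1 + \<alpha> x\<^sup>2) = 2 / \<alpha> - 2 /
  \<alpha> / (1 + \<alpha> x\<^sup>2)\<close> makes \<mu> the limit at infinity. The vortex equation
  has \<open>\<mu> = 2 (1 / \<alpha> - \<kappa>)\<close>.\<close>

definition saturable :: "real \<Rightarrow> real \<Rightarrow> real \<Rightarrow> real" where
  "saturable \<alpha> \<mu> x = \<mu> - 2 / \<alpha> / (1 + \<alpha> * x\<^sup>2)"

text \<open>The function \<open>x / (1 + \<alpha> x\<^sup>2)\<close> is 1-Lipschitz: its difference
  quotient is \<open>(1 - \<alpha> x y) / ((1 + \<alpha> x\<^sup>2) (1 + \<alpha>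
  y\<^sup>2))\<close>, and \<open>2 \<bar>x y\<bar> \<le> x\<^sup>2 + y\<^sup>2\<close> bounds it by
  1.\<close>

lemma lipschitz_nonlinearity_saturable:
  assumes \<alpha>: "\<alpha> > 0"
  shows "lipschitz_nonlinearity (\<bar>\<mu>\<bar> + 2 / \<alpha>) (saturable \<alpha> \<mu>)"
proof -
  have p: "1 + \<alpha> * x\<^sup>2 > 0" "1 + \<alpha> * x\<^sup>2 \<ge> 1" for x
    using \<alpha> by (simp_all add: add_pos_nonneg)
  have 1: "\<bar>x / (1 + \<alpha> * x\<^sup>2) - y / (1 + \<alpha> * y\<^sup>2)\<bar> \<le> \<bar>x - y\<bar>" for x y
  proof -
    have "2 * \<bar>x * y\<bar> \<le> x\<^sup>2 + y\<^sup>2" using sum_squares_bound[of "\<bar>x\<bar>" "\<bar>y\<bar>"] by (simp add: abs_mult)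
    then have "\<alpha> * (2 * \<bar>x * y\<bar>) \<le> \<alpha> * (x\<^sup>2 + y\<^sup>2)" using \<alpha> by simp
    moreover have "\<bar>1 - \<alpha> * (x * y)\<bar> \<le> 1 + \<alpha> * \<bar>x * y\<bar>"
      using \<alpha> abs_triangle_ineq4[of 1 "\<alpha> * (x * y)"] by (simp add: abs_mult)
    moreover have "0 \<le> \<alpha> * (x\<^sup>2 + y\<^sup>2)" "0 \<le> \<alpha> * x\<^sup>2 * (\<alpha> * y\<^sup>2)" using \<alpha> by simp_all
    ultimately have "\<bar>1 - \<alpha> * (x * y)\<bar> \<le> 1 + \<alpha> * (x\<^sup>2 + y\<^sup>2) + \<alpha> * x\<^sup>2 * (\<alpha> * y\<^sup>2)" by linarith
    also have "\<dots> = (1 + \<alpha> * x\<^sup>2) * (1 + \<alpha> * y\<^sup>2)" by (simp add: algebra_simps)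
    finally have le: "\<bar>1 - \<alpha> * (x * y)\<bar> \<le> (1 + \<alpha> * x\<^sup>2) * (1 + \<alpha> * y\<^sup>2)" .
    have "x / (1 + \<alpha> * x\<^sup>2) - y / (1 + \<alpha> * y\<^sup>2) =
        (x - y) * ((1 - \<alpha> * (x * y)) / ((1 + \<alpha> * x\<^sup>2) * (1 + \<alpha> * y\<^sup>2)))"
      using p[of x] p[of y] by (simp add: diff_frac_eq less_imp_neq[THEN not_sym]) (simp add: algebra_simps power2_eq_square)
    moreover have "\<bar>(1 - \<alpha> * (x * y)) / ((1 + \<alpha> * x\<^sup>2) * (1 + \<alpha> * y\<^sup>2))\<bar> \<le> 1"
      using le p(1)[of x] p(1)[of y] by (simp add: abs_divide abs_mult)
    then have "\<bar>x - y\<bar> * \<bar>(1 - \<alpha> * (x * y)) / ((1 + \<alpha> * x\<^sup>2) * (1 + \<alpha> * y\<^sup>2))\<bar> \<le> \<bar>x - y\<bar> * 1"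
      by (intro mult_left_mono) auto
    ultimately show ?thesis by (simp only: abs_mult mult_1_right)
  qed
  have "\<bar>saturable \<alpha> \<mu> x * x - saturable \<alpha> \<mu> y * y\<bar> \<le> (\<bar>\<mu>\<bar> + 2 / \<alpha>) * \<bar>x - y\<bar>" for x y
  proof -
    have "saturable \<alpha> \<mu> x * x - saturable \<alpha> \<mu> y * y =
      \<mu> * (x - y) - 2 / \<alpha> * (x / (1 + \<alpha> * x\<^sup>2) - y / (1 + \<alpha> * y\<^sup>2))"
      by (simp add: saturable_def algebra_simps)
    also have "\<bar>\<dots>\<bar> \<le> \<bar>\<mu>\<bar> * \<bar>x - y\<bar> + 2 / \<alpha> * \<bar>x / (1 + \<alpha> * x\<^sup>2) - y / (1 + \<alpha> * y\<^sup>2)\<bar>"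
      using abs_of_pos[of "2 / \<alpha>"] \<alpha>
      by (intro order_trans[OF abs_triangle_ineq4]) (simp only: abs_mult divide_pos_pos zero_less_numeral order.refl)
    also have "\<dots> \<le> \<bar>\<mu>\<bar> * \<bar>x - y\<bar> + 2 / \<alpha> * \<bar>x - y\<bar>"
      using \<alpha> by (intro add_left_mono mult_left_mono 1) auto
    finally show ?thesis by (simp add: distrib_right)
  qed
  moreover have "\<bar>saturable \<alpha> \<mu> x\<bar> \<le> \<bar>\<mu>\<bar> + 2 / \<alpha>" for x
  proof -
    have "2 / \<alpha> / (1 + \<alpha> * x\<^sup>2) \<le> 2 / \<alpha> / 1" 
      by (intro divide_left_mono mult_pos_pos p zero_less_one) (use \<alpha> in auto)
    moreover have "0 \<le> 2 / \<alpha> / (1 + \<alpha> * x\<^sup>2)" 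
      by (intro divide_nonneg_nonneg less_imp_le[OF \<alpha>] less_imp_le[OF p(1)]) simp
    ultimately show ?thesis unfolding saturable_def by linarith
  qed
  moreover have "continuous_on UNIV (saturable \<alpha> \<mu>)" unfolding saturable_def
    using p(1) by (intro continuous_intros) (auto simp: less_imp_neq[THEN not_sym])
  ultimately show ?thesis using \<alpha> by (auto simp: lipschitz_nonlinearity_def add_nonneg_pos)
qed

lemma saturable_eq:
  assumes "\<alpha> > 0"
  shows "saturable \<alpha> (2 * (1 / \<alpha> - \<kappa>)) x = 2 * x\<^sup>2 / (1 + \<alpha> * x\<^sup>2) - 2 * \<kappa>"
proof -
  define D where "D = 1 + \<alpha> * x\<^sup>2"
  have "D > 0" using assms by (simp add: D_def add_pos_nonneg)
  then have "2 / \<alpha> - 2 / \<alpha> / D = 2 * ((D - 1) / \<alpha>) / D" using assms by (simp add: field_simps)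
  also have "(D - 1) / \<alpha> = x\<^sup>2" using assms by (simp add: D_def)
  finally show ?thesis unfolding saturable_def D_def[symmetric] by (simp add: right_diff_distrib)
qed

section \<open>Return to the vortex equation, and the two extreme amplitudes\<close>

lemma radial_sol_linear_scale:
  assumes "radial_sol m R (\<lambda>_. \<nu>) y"
  shows "radial_sol m R (\<lambda>_. \<nu>) (\<lambda>r. a * y r)"
proof -
  have "radial_rhs m (\<lambda>_. \<nu>) (\<lambda>r. a * y r) = (\<lambda>r. a * radial_rhs m (\<lambda>_. \<nu>) y r)"
    by (auto simp: radial_rhs_def)
  moreover have "radial_avg q (\<lambda>r. a * g r) = (\<lambda>r. a * radial_avg q g r)" for q g
    by (auto simp: radial_avg_def mult.left_commute)
  ultimately have "radial_avg q (radial_rhs m (\<lambda>_. \<nu>) (\<lambda>r. a * y r)) =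
      (\<lambda>r. a * radial_avg q (radial_rhs m (\<lambda>_. \<nu>) y) r)" for q by simp
  then have e: "integral {0..r} (radial_avg q (radial_rhs m (\<lambda>_. \<nu>) (\<lambda>r. a * y r))) =
      a * integral {0..r} (radial_avg q (radial_rhs m (\<lambda>_. \<nu>) y))" for q r by simp
  show ?thesis unfolding radial_sol_def e
  proof (intro conjI ballI)
    show "continuous_on {0..R} (\<lambda>r. a * y r)"
      using assms by (intro continuous_on_mult_left) (simp add: radial_sol_def)
    fix r assume "r \<in> {0..R}"
    with assms have "y r = y 0 - integral {0..r} (radial_avg (2 * m + 1) (radial_rhs m (\<lambda>_. \<nu>) y))"
      unfolding radial_sol_def by blast
    then show "a * y r = a * y 0 - a * integral {0..r} (radial_avg (2 * m + 1) (radial_rhs m (\<lambda>_. \<nu>) y))"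
      unfolding right_diff_distrib[symmetric] by (rule arg_cong)
  qed
qed

text \<open>The profile is \<open>C\<^sup>1\<close> up to the boundary, so a constant Cauchy sequence witnesses membership.\<close>

lemma radial_sol_in_H:
  assumes v: "radial_sol m R f v" and f: "continuous_on UNIV f" and m: "m \<ge> 1" and vR: "v R = 0"
  shows "in_H R (\<lambda>r. r ^ m * v r)"
proof -
  define u where "u = (\<lambda>r. r ^ m * v r)"
  define u' where "u' = (\<lambda>r. real m * r ^ (m - 1) * v r + r ^ m * radial_deriv m f v r)"
  have "(u has_real_derivative u' r) (at r within {0..R})" if "r \<in> {0..R}" for r
    unfolding u_def u'_def
    by (rule derivative_eq_intros refl radial_sol_has_derivative_within[OF v f that])+ simp
  moreover have "continuous_on {0..R} u'" unfolding u'_def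
    by (intro continuous_intros radial_sol_continuous[OF v f] continuous_on_radial_deriv[OF v f])
  ultimately have "C1_0 R u u'" using m vR by (auto simp: C1_0_def u_def)
  then show ?thesis unfolding in_H_def u_def[symmetric]
    by (intro exI[of _ "\<lambda>_. u"] exI[of _ "\<lambda>_. u'"]) (auto simp: H_norm2_def)
qed

text \<open>With \<open>u' = w / r\<close> for the flux \<open>w\<close>, the expression
  \<open>u' + r u''\<close> is \<open>w'\<close>, so the equation is the derivative formula for the
  flux.\<close>

lemma radial_sol_vortex:
  assumes v: "radial_sol m R (saturable \<alpha> (2 * (1 / \<alpha> - \<kappa>))) v" and \<alpha>: "\<alpha> > 0" and m: "m \<ge> 1"
    and n: "(real m)\<^sup>2 = (of_int n)\<^sup>2" and vR: "v R = 0"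
  shows "vortex_solution n \<alpha> R (\<lambda>r. r ^ m * v r) \<kappa>"
proof -
  define f where "f = saturable \<alpha> (2 * (1 / \<alpha> - \<kappa>))"
  have fc: "continuous_on UNIV f"
    using lipschitz_nonlinearity_saturable[OF \<alpha>] by (auto simp: lipschitz_nonlinearity_def f_def)
  have v: "radial_sol m R f v" using v by (simp add: f_def)
  define u where "u = (\<lambda>r. r ^ m * v r)"
  define w where "w = radial_flux m f v"
  define w' where "w' = (\<lambda>r. (real m)\<^sup>2 / r * u r - r * f (u r) * u r)"
  have key: "(u has_real_derivative w r / r) (at r) \<and>
     ((\<lambda>r. w r / r) has_real_derivative (w' r * r - w r * 1) / (r * r)) (at r) \<and>
     (w r / r + r * ((w' r * r - w r * 1) / (r * r))) - (of_int n)\<^sup>2 / r * u r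
          + 2 * r * (u r) ^ 3 / (1 + \<alpha> * (u r)\<^sup>2) - 2 * \<kappa> * r * u r = 0"
    if r: "r \<in> {0<..<R}" for r
  proof (intro conjI)
    have r': "0 < r" "r < R" using r by auto
    show "(u has_real_derivative w r / r) (at r)"
      unfolding u_def w_def by (rule radial_profile_has_derivative[OF v fc r'])
    have "(w has_real_derivative w' r) (at r)"
      unfolding w'_def u_def w_def by (rule radial_flux_has_derivative[OF v fc r'])
    then show "((\<lambda>r. w r / r) has_real_derivative (w' r * r - w r * 1) / (r * r)) (at r)"
      using r' by (intro DERIV_divide DERIV_ident) auto
    define x where "x = u r"
    have fx: "f x * x = 2 * x ^ 3 / (1 + \<alpha> * x\<^sup>2) - 2 * \<kappa> * x"
      unfolding f_def saturable_eq[OF \<alpha>] by (simp add: left_diff_distrib power3_eq_cube power2_eq_square)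
    have "w r / r + r * ((w' r * r - w r * 1) / (r * r)) = w' r"
      using r' by (simp add: field_simps)
    also have "w' r = (of_int n)\<^sup>2 / r * x - r * (f x * x)" by (simp add: w'_def x_def n)
    finally show "(w r / r + r * ((w' r * r - w r * 1) / (r * r))) - (of_int n)\<^sup>2 / r * u r
          + 2 * r * (u r) ^ 3 / (1 + \<alpha> * (u r)\<^sup>2) - 2 * \<kappa> * r * u r = 0"
      unfolding x_def[symmetric] fx by (simp add: algebra_simps)
  qed
  have "continuous_on {0..R} u" unfolding u_def
    by (intro continuous_intros radial_sol_continuous[OF v fc])
  moreover have "u 0 = 0" "u R = 0" using m vR by (auto simp: u_def)
  ultimately show ?thesis unfolding vortex_solution_def u_def[symmetric]
    by - (rule conjI, assumption, rule conjI, assumption, rule conjI, assumption,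
        rule exI[of _ "\<lambda>r. w r / r"],
        rule exI[of _ "\<lambda>r. (w' r * r - w r * 1) / (r * r)"], rule ballI, erule key)
qed

lemma radial_sol_abs_le:
  assumes "R > 0" "radial_sol m R f v" "lipschitz_nonlinearity L f" "r \<in> {0..R}"
  shows "\<bar>v r\<bar> \<le> \<bar>v 0\<bar> * exp (L * R * R)"
  using radial_sol_perturb[OF assms(1,2) radial_sol_zero[of m R f] _ assms(3) order.refl _ assms(4)] assms(3)
  by (simp add: lipschitz_nonlinearity_def)

text \<open>For small amplitude the solution is close to \<open>a y\<close>, where \<open>y\<close> solves the linearisation at \<open>0\<close>.\<close>

lemma radial_sol_small_pos:
  assumes \<alpha>: "\<alpha> > 0" and R: "R > 0" and m: "m \<ge> 1"
    and \<nu>R: "- 2 * \<kappa> * R\<^sup>2 < (real m)\<^sup>2 + r0\<^sup>2"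
  obtains a where "0 < a" "a \<le> 1"
    "\<And>v r. radial_sol m R (saturable \<alpha> (2 * (1 / \<alpha> - \<kappa>))) v \<Longrightarrow> v 0 = a \<Longrightarrow> r \<in> {0..R} \<Longrightarrow> v r > 0"
proof -
  define \<nu> where "\<nu> = - 2 * \<kappa>"
  have \<nu>R: "\<nu> * R\<^sup>2 < (real m)\<^sup>2 + r0\<^sup>2" using \<nu>R by (simp add: \<nu>_def)
  define \<mu> where "\<mu> = 2 * (1 / \<alpha> - \<kappa>)"
  define f where "f = saturable \<alpha> \<mu>"
  define L where "L = \<bar>\<mu>\<bar> + 2 / \<alpha>"
  have fl: "lipschitz_nonlinearity L f" unfolding f_def L_def by (rule lipschitz_nonlinearity_saturable[OF \<alpha>])
  then have fc: "continuous_on UNIV f" by (auto simp: lipschitz_nonlinearity_def)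
  define K where "K = exp (L * R * R)"
  have K: "K > 0" by (simp add: K_def)
  obtain y where y: "radial_sol m R (\<lambda>_. \<nu>) y" "y 0 = 1"
    using radial_sol_exists[OF R lipschitz_nonlinearity_const] by metis
  have ypos: "y r > 0" if "r \<in> {0..R}" for r
    by (rule radial_sol_linear_pos[OF R m y(1) _ \<nu>R that]) (simp add: y)
  have "\<exists>x\<in>{0..R}. \<forall>t\<in>{0..R}. y x \<le> y t"
    using R by (intro continuous_attains_inf radial_sol_continuous[OF y(1)]) auto
  then obtain c where c: "c > 0" "\<And>t. t \<in> {0..R} \<Longrightarrow> c \<le> y t" using ypos by metis
  \<comment> \<open>Along a solution of amplitude \<open>a\<close> both
    \<open>\<bar>f - \<nu>\<bar> \<le> 2 x\<^sup>2\<close> and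
    \<open>\<bar>v\<bar> \<le> a K\<close> hold, so the defect is at most
    \<open>a\<^sup>3 E\<close>, weakened to \<open>a\<^sup>2 E\<close> for \<open>a \<le> 1\<close>.
    It loses against \<open>a y \<ge> a c\<close> once \<open>a D < c\<close>.\<close>
  define E where "E = R * (2 * (R ^ m * K)\<^sup>2) * K"
  define D where "D = E * R * exp ((\<bar>\<nu>\<bar> + 1) * R * R)"
  have E: "E \<ge> 0" and D: "D \<ge> 0" using R K by (auto simp: D_def E_def)
  define a where "a = min 1 (c / (D + 1))"
  have a: "0 < a" "a \<le> 1" using c D by (auto simp: a_def)
  have "a * D \<le> c / (D + 1) * D" using D by (intro mult_right_mono) (auto simp: a_def)
  also have "\<dots> < c" using c D by (simp add: field_simps)
  finally have aD: "a * D < c" .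
  have "v r > 0" if v: "radial_sol m R f v" "v 0 = a" and r: "r \<in> {0..R}" for v r
  proof -
    have "\<bar>v r - a * y r\<bar> \<le> (\<bar>v 0 - a * y 0\<bar> + (a * (a * E)) * R) * exp ((\<bar>\<nu>\<bar> + 1) * R * R)"
    proof (rule radial_sol_perturb[OF R v(1) radial_sol_linear_scale[OF y(1)] fc
          lipschitz_nonlinearity_const _ _ r])
      fix t assume t: "t \<in> {0..R}"
      define x where "x = t ^ m * v t"
      have vt: "\<bar>v t\<bar> \<le> a * K" using radial_sol_abs_le[OF R v(1) fl t] a by (simp add: v K_def)
      have "\<bar>x\<bar> \<le> R ^ m * (a * K)" unfolding x_def abs_mult power_abs
        using t vt by (intro mult_mono power_mono) auto
      then have "\<bar>x\<bar>\<^sup>2 \<le> (R ^ m * (a * K))\<^sup>2" by (intro power_mono) auto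
      then have x2: "x\<^sup>2 \<le> a\<^sup>2 * (R ^ m * K)\<^sup>2" by (simp add: power_mult_distrib mult_ac)
      have "1 + \<alpha> * x\<^sup>2 \<ge> 1" using \<alpha> by simp
      have "f x - \<nu> = 2 * x\<^sup>2 / (1 + \<alpha> * x\<^sup>2)"
        unfolding f_def \<mu>_def \<nu>_def saturable_eq[OF \<alpha>] by simp
      also have "\<bar>\<dots>\<bar> \<le> 2 * x\<^sup>2"
        using \<open>1 + \<alpha> * x\<^sup>2 \<ge> 1\<close> divide_left_mono[of 1 "1 + \<alpha> * x\<^sup>2" "2 * x\<^sup>2"] by (simp add: abs_divide abs_mult)
      finally have fx: "\<bar>f x - \<nu>\<bar> \<le> a\<^sup>2 * (2 * (R ^ m * K)\<^sup>2)" using x2 by linarith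
      have "t * \<bar>f x * v t - \<nu> * v t\<bar> = t * (\<bar>f x - \<nu>\<bar> * \<bar>v t\<bar>)"
        by (simp flip: abs_mult add: left_diff_distrib)
      also have "\<dots> \<le> R * ((a\<^sup>2 * (2 * (R ^ m * K)\<^sup>2)) * (a * K))"
        using t a R by (intro mult_mono fx vt) auto
      also have "\<dots> = a * (a * (a * E))" by (simp add: E_def power2_eq_square)
      also have "\<dots> \<le> a * (a * E)" using a E by (intro mult_left_mono mult_left_le_one_le) auto
      finally show "t * \<bar>f (t ^ m * v t) * v t - \<nu> * v t\<bar> \<le> a * (a * E)"
        by (simp add: x_def)
    qed (use a E in auto)
    also have "\<dots> = a * (a * D)" by (simp add: v(2) y(2) D_def)
    also have "\<dots> < a * c" using a aD by simp
    also have "\<dots> \<le> a * y r" using a c(2)[OF r] by simp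
    finally show ?thesis by linarith
  qed
  with a that show ?thesis unfolding f_def \<mu>_def by blast
qed

text \<open>For large amplitude the solution is close to \<open>b z\<close>, where \<open>z\<close> solves the linearisation at
  infinity. The two nonlinearities differ most near \<open>r = 0\<close>, where \<open>u\<close> is not large; there the
  weight \<open>t\<close> in the perturbation estimate compensates.\<close>

lemma radial_sol_large_neg:
  assumes \<alpha>: "\<alpha> > 0" and R: "R > 0" and m: "m \<ge> 1" and S: "0 < S" "S < R"
    and \<mu>S: "12 * (1 + (real m)\<^sup>2 * (2 * ln 2 - 1)) < \<mu> * S\<^sup>2"
  obtains b r where "b \<ge> 1" "r \<in> {0..R}"
    "\<And>v. radial_sol m R (saturable \<alpha> \<mu>) v \<Longrightarrow> v 0 = b \<Longrightarrow> v r < 0"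
proof -
  define f where "f = saturable \<alpha> \<mu>"
  define L where "L = \<bar>\<mu>\<bar> + 2 / \<alpha>"
  have fl: "lipschitz_nonlinearity L f" unfolding f_def L_def by (rule lipschitz_nonlinearity_saturable[OF \<alpha>])
  then have fc: "continuous_on UNIV f" by (auto simp: lipschitz_nonlinearity_def)
  define K where "K = exp (L * R * R)"
  have K: "K > 0" by (simp add: K_def)
  obtain z where z: "radial_sol m R (\<lambda>_. \<mu>) z" "z 0 = 1"
    using radial_sol_exists[OF R lipschitz_nonlinearity_const] by metis
  obtain r where r: "r \<in> {0..R}" "z r < 0"
    using radial_sol_linear_nonneg_bound[OF z(1) _ _ S] z(2) \<mu>S by force
  define K' where "K' = exp ((\<bar>\<mu>\<bar> + 1) * R * R)"
  \<comment> \<open>Makes the final error half of \<open>b \<bar>z r\<bar>\<close>, so that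
    \<open>v r\<close> keeps the sign of \<open>z r\<close>.\<close>
  define \<epsilon> where "\<epsilon> = - z r / (2 * R * K')"
  have K': "K' > 0" by (simp add: K'_def)
  have \<epsilon>: "\<epsilon> > 0" "\<epsilon> * R * K' = - z r / 2" using r R K' by (auto simp: \<epsilon>_def intro!: divide_neg_pos)
  \<comment> \<open>For \<open>t \<le> \<delta>\<close> the crude bound
    \<open>\<bar>v t\<bar> \<le> b K\<close> already gives a weighted defect of at most
    \<open>b \<epsilon>\<close>. Beyond \<delta> the bound is \<open>B\<close>. None of \<delta>,
    \<open>\<beta>\<close>, \<open>B\<close> depends on \<open>b\<close>, so \<open>b\<close> can be
    chosen last.\<close>
  define \<delta> where "\<delta> = \<epsilon> * \<alpha> / (2 * K)"
  define \<beta> where "\<beta> = \<alpha> * (\<delta> ^ m)\<^sup>2"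
  have \<delta>: "\<delta> > 0" and \<beta>: "\<beta> > 0" using \<epsilon> \<alpha> K by (auto simp: \<delta>_def \<beta>_def)
  define B where "B = R * (2 / \<alpha> * (1 + 1 / \<beta>))"
  define b where "b = max 1 (B / \<epsilon>)"
  have "b \<ge> 1" "B / \<epsilon> \<le> b" by (simp_all add: b_def)
  then have b: "b \<ge> 1" "B \<le> b * \<epsilon>" using \<epsilon>(1) by (simp_all add: pos_divide_le_eq)
  have "v r < 0" if v: "radial_sol m R f v" "v 0 = b" for v
  proof -
    have "\<bar>v r - b * z r\<bar> \<le> (\<bar>v 0 - b * z 0\<bar> + (b * \<epsilon>) * R) * exp ((\<bar>\<mu>\<bar> + 1) * R * R)"
    proof (rule radial_sol_perturb[OF R v(1) radial_sol_linear_scale[OF z(1)] fc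
          lipschitz_nonlinearity_const _ _ r(1)])
      fix t assume t: "t \<in> {0..R}"
      define x where "x = \<bar>v t\<bar>"
      define D where "D = 1 + \<alpha> * (t ^ m)\<^sup>2 * x\<^sup>2"
      have D1: "D \<ge> 1" using \<alpha> by (simp add: D_def)
      have "f (t ^ m * v t) * v t - \<mu> * v t = - (2 / \<alpha> * (v t / D))"
        by (simp add: f_def saturable_def D_def x_def power_mult_distrib left_diff_distrib mult.assoc)
      then have e: "\<bar>f (t ^ m * v t) * v t - \<mu> * v t\<bar> = 2 / \<alpha> * (x / D)"
        using \<alpha> D1 by (simp add: x_def abs_mult)
      have x: "0 \<le> x" "x \<le> b * K" using radial_sol_abs_le[OF R v(1) fl t] b by (auto simp: x_def v K_def)
      have "t * (2 / \<alpha> * (x / D)) \<le> b * \<epsilon>"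
      proof (cases "t \<le> \<delta>")
        case True
        have "x / D \<le> b * K" using x D1 divide_left_mono[of 1 D x] by simp
        then have "t * (2 / \<alpha> * (x / D)) \<le> \<delta> * (2 / \<alpha> * (b * K))"
          using True t \<alpha> \<delta> x D1 by (intro mult_mono) auto
        also have "\<dots> = b * \<epsilon>" using \<alpha> K by (simp add: \<delta>_def)
        finally show ?thesis .
      next
        case False
        have "\<beta> \<le> \<alpha> * (t ^ m)\<^sup>2" unfolding \<beta>_def
          using False \<alpha> \<delta> by (intro mult_left_mono power_mono) auto
        then have "1 + \<beta> * x\<^sup>2 \<le> D" unfolding D_def by (intro add_left_mono mult_right_mono) auto
        \<comment> \<open>Damping away from 0: the defect stays bounded however large
          \<open>v\<close> is.\<close>
        moreover have "x \<le> (1 + 1 / \<beta>) * (1 + \<beta> * x\<^sup>2)"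
        proof -
          have "(1 + 1 / \<beta>) * (1 + \<beta> * x\<^sup>2) = 1 + 1 / \<beta> + \<beta> * x\<^sup>2 + x\<^sup>2" using \<beta> by (simp add: field_simps)
          moreover have "0 \<le> (x - 1)\<^sup>2" by simp
          then have "2 * x \<le> 1 + x\<^sup>2" by (simp add: power2_diff)
          moreover have "0 < 1 / \<beta>" "0 \<le> \<beta> * x\<^sup>2" using \<beta> by simp_all
          ultimately show ?thesis using x by linarith
        qed
        ultimately have "x \<le> (1 + 1 / \<beta>) * D"
          using \<beta> by (elim order_trans) (intro mult_left_mono, auto)
        then have "x / D \<le> 1 + 1 / \<beta>" using D1 by (simp add: divide_le_eq)
        then have "t * (2 / \<alpha> * (x / D)) \<le> B" unfolding B_def
          using t \<alpha> x D1 R by (intro mult_mono) auto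
        then show ?thesis using b by linarith
      qed
      then show "t * \<bar>f (t ^ m * v t) * v t - \<mu> * v t\<bar> \<le> b * \<epsilon>" by (simp only: e)
    qed (use b \<epsilon> in auto)
    also have "\<dots> = b * (\<epsilon> * R * K')" by (simp add: v(2) z(2) K'_def)
    also have "\<dots> = - (b * z r) / 2" unfolding \<epsilon>(2) by simp
    finally have "v r \<le> b * z r / 2" by linarith
    also have "\<dots> < 0" using b r by (simp add: mult_pos_neg)
    finally show ?thesis .
  qed
  with b r that show ?thesis unfolding f_def by blast
qed

section \<open>Intermediate value argument in the amplitude\<close>

theorem theorem4p7:
  fixes n :: int and \<alpha> R \<kappa> :: real
  assumes "\<bar>n\<bar> \<ge> 1" and "\<alpha> > 0" and "R > 0"
    and "- ((of_int n)^2 + r0^2) / (2 * R^2) < \<kappa>"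
    and "\<kappa> < 1 / \<alpha> - ((of_int n)^2 + r0^2) / (2 * R^2)"
    and "sqrt (6 * (1 + (of_int n)^2 * (2 * ln 2 - 1)) / (1 / \<alpha> - \<kappa>)) < R"
  shows "\<exists>u. in_H R u \<and> (\<forall>r\<in>{0<..<R}. u r > 0) \<and> vortex_solution n \<alpha> R u \<kappa>"
proof -
  note \<alpha> = assms(2) and R = assms(3)
  define m where "m = nat \<bar>n\<bar>"
  have m: "m \<ge> 1" and n: "(real m)\<^sup>2 = (of_int n)\<^sup>2" using assms(1) by (auto simp: m_def)
  define \<mu> where "\<mu> = 2 * (1 / \<alpha> - \<kappa>)"
  define f where "f = saturable \<alpha> \<mu>"
  define L where "L = \<bar>\<mu>\<bar> + 2 / \<alpha>"
  have fl: "lipschitz_nonlinearity L f" unfolding f_def L_def by (rule lipschitz_nonlinearity_saturable[OF \<alpha>])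
  then have fc: "continuous_on UNIV f" and fL: "\<And>x. \<bar>f x\<bar> \<le> L" by (auto simp: lipschitz_nonlinearity_def)
  have "\<exists>v. radial_sol m R f v \<and> v 0 = a" for a
    using radial_sol_exists[OF R fl] by metis
  then obtain V where V: "\<And>a. radial_sol m R f (V a)" "\<And>a. V a 0 = a" by metis
  define K where "K = exp (L * R * R)"
  have K: "K > 0" by (simp add: K_def)
  have V_lip: "\<bar>V a r - V b r\<bar> \<le> \<bar>a - b\<bar> * K" if "r \<in> {0..R}" for a b r
    using radial_sol_perturb[OF R V(1) V(1) fc fl order.refl _ that, of a b] by (simp add: V(2) K_def)
  have Vc: "continuous_on {0..R} (V a)" for a by (rule radial_sol_continuous[OF V(1) fc])
  have "\<exists>\<rho>\<in>{0..R}. \<forall>t\<in>{0..R}. V a \<rho> \<le> V a t" for a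
    using R by (intro continuous_attains_inf Vc) auto
  then obtain \<rho> where \<rho>: "\<And>a. \<rho> a \<in> {0..R}" "\<And>a t. t \<in> {0..R} \<Longrightarrow> V a (\<rho> a) \<le> V a t" by metis
  define N where "N a = V a (\<rho> a)" for a
  \<comment> \<open>Evaluate \<open>V a\<close> at the minimiser of \<open>V b\<close>: this bounds
    \<open>N a\<close> without any continuity of \<rho>.\<close>
  have N_le: "N a \<le> N b + \<bar>a - b\<bar> * K" for a b
    using \<rho>(2)[OF \<rho>(1), of a b] V_lip[OF \<rho>(1), of a b b] by (simp add: N_def abs_le_iff)
  have "dist (N a) (N b) \<le> K * dist a b" for a b
    using N_le[of a b] N_le[of b a] by (simp add: dist_real_def abs_le_iff abs_minus_commute mult.commute)
  then have "K-lipschitz_on UNIV N" using K by (intro lipschitz_onI) auto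
  then have Nc: "continuous_on S N" for S
    by (meson continuous_on_subset lipschitz_on_continuous_on top_greatest)
  have "- 2 * \<kappa> * R\<^sup>2 < (real m)\<^sup>2 + r0\<^sup>2" using assms(4) R by (simp add: n field_simps)
  then obtain a where a: "0 < a" "a \<le> 1"
    "\<And>v r. radial_sol m R f v \<Longrightarrow> v 0 = a \<Longrightarrow> r \<in> {0..R} \<Longrightarrow> v r > 0"
    using radial_sol_small_pos[OF \<alpha> R m] unfolding f_def \<mu>_def by blast
  have Na: "N a > 0" unfolding N_def by (rule a(3)[OF V \<rho>(1)])
  define q Y where "q = 1 / \<alpha> - \<kappa>" and "Y = 1 + (of_int n)\<^sup>2 * (2 * ln 2 - 1 :: real)"
  \<comment> \<open>The upper bound on \<kappa> enters here: it makes \<open>q\<close> positive, so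
    the condition on \<open>R\<close> can be squared and multiplied out.\<close>
  have "((of_int n)\<^sup>2 + r0\<^sup>2) / (2 * R\<^sup>2) > 0"
    using r0_props(1) R by (intro divide_pos_pos add_nonneg_pos) auto
  then have q: "q > 0" using assms(5) by (simp add: q_def)
  have "(2::real) / 3 \<le> ln 2" by (rule ln2_ge_two_thirds)
  then have Y: "Y > 0" by (auto simp: Y_def intro!: add_pos_nonneg)
  \<comment> \<open>The strict inequality for \<open>R\<close> leaves room for \<open>S < R\<close>,
    as the Picone bound requires.\<close>
  obtain S where S: "sqrt (6 * Y / q) < S" "S < R"
    using dense[OF assms(6)] by (auto simp: q_def Y_def)
  have sqY: "sqrt (6 * Y / q) > 0" using Y q by simp
  then have S0: "S > 0" using S(1) by linarith
  have "(sqrt (6 * Y / q))\<^sup>2 < S\<^sup>2" using S(1) sqY by (intro power_strict_mono) auto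
  then have "6 * Y < S\<^sup>2 * q" using Y q by (simp add: pos_divide_less_eq)
  then have "12 * Y < \<mu> * S\<^sup>2" by (simp add: \<mu>_def flip: q_def) (simp add: mult.commute)
  then have "12 * (1 + (real m)\<^sup>2 * (2 * ln 2 - 1)) < \<mu> * S\<^sup>2" by (simp add: n Y_def)
  then obtain b s where b: "b \<ge> 1" "s \<in> {0..R}" "\<And>v. radial_sol m R f v \<Longrightarrow> v 0 = b \<Longrightarrow> v s < 0"
    using radial_sol_large_neg[OF \<alpha> R m S0 S(2)] unfolding f_def by blast
  have Nb: "N b < 0" using \<rho>(2)[OF b(2), of b] b(3)[OF V] by (simp add: N_def)
  \<comment> \<open>The normalisations \<open>a \<le> 1\<close> and \<open>b \<ge> 1\<close> order
    the two amplitudes.\<close>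
  obtain c where c: "a \<le> c" "c \<le> b" "N c = 0"
    using IVT2'[of N b 0 a] Nc[of "{a..b}"] Na Nb a b by auto
  have nonneg: "V c r \<ge> 0" if "r \<in> {0..R}" for r using \<rho>(2)[OF that, of c] c(3) by (simp add: N_def)
  have pos: "V c r > 0" if "r \<in> {0..<R}" for r
    by (rule radial_sol_pos[OF V(1) fc fL _ nonneg that]) (use V(2) a c in auto)
  have "\<rho> c = R" using pos[of "\<rho> c"] c(3) \<rho>(1)[of c] by (cases "\<rho> c = R") (auto simp: N_def)
  then have VR: "V c R = 0" using c(3) by (simp add: N_def)
  show ?thesis
  proof (intro exI conjI ballI)
    show "in_H R (\<lambda>r. r ^ m * V c r)" by (rule radial_sol_in_H[where v = "V c", OF V(1) fc m VR])
    show "r ^ m * V c r > 0" if "r \<in> {0<..<R}" for r using that pos[of r] by simp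
    show "vortex_solution n \<alpha> R (\<lambda>r. r ^ m * V c r) \<kappa>"
      using V(1)[of c] unfolding f_def \<mu>_def by (rule radial_sol_vortex[OF _ \<alpha> m n, where v = "V c"]) (rule VR)
  qed
qed

end
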